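(* Let $b_1,\dots,b_n$ be a finite sequence of positive integers and $c$ a positive integer. Let $t=3+\sum_{i=1}^n b_i$, $k=\mathrm{lcm}(b_1,\dots,b_n,c)$, and let $q_0$ be the smallest positive integer such that $q_0k^{-t}-(t-1-t/k+k^{-t})\sqrt{q_0}-t/k>1$. Let $q$ be a prime power with $k\mid(q-1)$ and $q\ge q_0$. Then for any orthomorphisms $\theta_1,\dots,\theta_n$ over $\mathbb{F}_q$ with $\theta_i\in\mathscr{C}_{b_i}(q)$ for $1\le i\le n$, there exists a near-linear strong orthomorphism $\phi\in\mathscr{D}_c(q)$ which is orthogonal to each of $\theta_1,\dots,\theta_n$.
   Context: Let $\mathbb{F}_q$ be the finite field of order $q$. An orthomorphism is a permutation $\theta$ of $\mathbb{F}_q$ such that $x\mapsto\theta(x)-x$ is also a permutation; it is a strong orthomorphism if moreover $x\mapsto\theta(x)+x$ is a permutation. Two orthomorphisms $\theta,\theta'$ are orthogonal if $x\mapsto\theta(x)-\theta'(x)$ is a permutation. For $k\mid(q-1)$, fix a generator $g$ of $\mathbb{F}_q^*$ and let $C_{k,i}=\{g^j: j\equiv i\pmod k\}$, $0\le i<k$. A cyclotomic map of index $k$ with multipliers $[a_0,\dots,a_{k-1}]$ is $\theta(0)=0$, $\theta(x)=a_ix$ for $x\in C_{k,i}$. $\mathscr{C}_k(q)$ is the set of orthomorphisms that are cyclotomic maps of index $k$, and $\mathscr{D}_k(q)=\mathscr{C}_k(q)\setminus\bigcup_{\ell<k,\ \ell\mid(q-1)}\mathscr{C}_\ell(q)$.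 An element of $\mathscr{C}_k(q)$ with multipliers $[a_0,\dots,a_{k-1}]$ is near-linear if $a_0\neq a_1=\cdots=a_{k-1}$. *)

theory Defs
  imports Complex_Main "HOL-Library.Cardinality" "HOL-Number_Theory.Cong"
begin

text \<open>
  The field of order \<open>q\<close> is an arbitrary type \<open>'a\<close> of classes \<open>finite\<close> and \<open>field\<close>, with
  \<open>q = CARD('a)\<close>. The generator \<open>g\<close> of the multiplicative group is an explicit parameter.
\<close>

definition orthomorphism :: "('a::{finite,field} \<Rightarrow> 'a) \<Rightarrow> bool" where
  "orthomorphism \<theta> \<longleftrightarrow> bij \<theta> \<and> bij (\<lambda>x. \<theta> x - x)"

definition strong_orthomorphism :: "('a::{finite,field} \<Rightarrow> 'a) \<Rightarrow> bool" where
  "strong_orthomorphism \<theta> \<longleftrightarrow> orthomorphism \<theta> \<and> bij (\<lambda>x. \<theta> x + x)"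

definition orthogonal_maps :: "('a::{finite,field} \<Rightarrow> 'a) \<Rightarrow> ('a \<Rightarrow> 'a) \<Rightarrow> bool" where
  "orthogonal_maps \<theta> \<theta>' \<longleftrightarrow> bij (\<lambda>x. \<theta> x - \<theta>' x)"

definition mult_generator :: "'a::{finite,field} \<Rightarrow> bool" where
  "mult_generator g \<longleftrightarrow> range (\<lambda>j::nat. g ^ j) = UNIV - {0}"

definition cyclotomic_coset :: "'a::{finite,field} \<Rightarrow> nat \<Rightarrow> nat \<Rightarrow> 'a set" where
  "cyclotomic_coset g k i = {g ^ j | j::nat. [j = i] (mod k)}"

text \<open>
  The multipliers are the values \<open>a 0, \<dots>, a (k - 1)\<close>; other values of \<open>a\<close> are irrelevant.
  Positivity of \<open>k\<close> follows from \<open>k dvd CARD('a) - 1\<close>, because \<open>CARD('a) \<ge> 2\<close>.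
\<close>

definition cyclotomic_map ::
    "'a::{finite,field} \<Rightarrow> nat \<Rightarrow> (nat \<Rightarrow> 'a) \<Rightarrow> ('a \<Rightarrow> 'a) \<Rightarrow> bool" where
  "cyclotomic_map g k a \<theta> \<longleftrightarrow>
     k dvd CARD('a) - 1 \<and> \<theta> 0 = 0 \<and>
     (\<forall>i<k. \<forall>x\<in>cyclotomic_coset g k i. \<theta> x = a i * x)"

definition cyclotomic_orthomorphisms ::
    "'a::{finite,field} \<Rightarrow> nat \<Rightarrow> ('a \<Rightarrow> 'a) set" where
  "cyclotomic_orthomorphisms g k = {\<theta>. orthomorphism \<theta> \<and> (\<exists>a. cyclotomic_map g k a \<theta>)}"

definition least_index_orthomorphisms ::
    "'a::{finite,field} \<Rightarrow> nat \<Rightarrow> ('a \<Rightarrow> 'a) set" where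
  "least_index_orthomorphisms g k =
     cyclotomic_orthomorphisms g k -
     (\<Union>l\<in>{l. l < k \<and> l dvd CARD('a) - 1}. cyclotomic_orthomorphisms g l)"

text \<open>
  The condition \<open>a\<^sub>0 \<noteq> a\<^sub>1 = \<dots> = a\<^bsub>k-1\<^esub>\<close> ranges over the multipliers with index \<open>1 \<le> i < k\<close>.
  For \<open>k = 1\<close> there are none, and every element of \<open>cyclotomic_orthomorphisms g 1\<close>, that is,
  every linear orthomorphism, counts as near-linear.
\<close>

definition near_linear :: "'a::{finite,field} \<Rightarrow> nat \<Rightarrow> ('a \<Rightarrow> 'a) \<Rightarrow> bool" where
  "near_linear g k \<theta> \<longleftrightarrow>
     \<theta> \<in> cyclotomic_orthomorphisms g k \<and>
     (\<exists>a. cyclotomic_map g k a \<theta> \<and> (\<forall>i\<in>{1..<k}. a 0 \<noteq> a i \<and> a i = a 1))"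

end

theory Submission
  imports Defs "HOL-Algebra.Algebraic_Closure_Type"
begin

text \<open>
  Let \<open>e = (q - 1) / k\<close> and let \<open>A\<close> be the set of all quotients \<open>\<theta>\<^sub>i x / x\<close>, of size at most
  \<open>S = b\<^sub>1 + \<dots> + b\<^sub>n\<close>. Suppose that \<open>(u - d)\<^sup>e = (- d)\<^sup>e\<close> for all \<open>d \<in> A\<close> and \<open>u \<in> {a, a'}\<close>, and that \<open>a\<close>,
  \<open>a \<plusminus> 1\<close> have the same \<open>e\<close>-th powers as \<open>a'\<close>, \<open>a' \<plusminus> 1\<close>. Then the map with multipliers
  \<open>[a, a', \<dots>, a']\<close> induces on the cosets of index \<open>k\<close> the same maps as \<open>x \<mapsto> a' x\<close>, its difference
  with \<open>\<theta>\<^sub>i\<close> the same ones as \<open>- \<theta>\<^sub>i\<close>, and so on, so that all of them are permutations. By the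
  pigeonhole principle such \<open>a \<noteq> a'\<close> exist as soon as more than \<open>k\<^sup>3 + 3\<close> elements \<open>u\<close> satisfy the
  conditions at \<open>A\<close>.

  Expanding these conditions in characters of order \<open>k\<close> gives a main term \<open>q / k\<^bsup>S\<^esup>\<close>. Because only
  \<open>S\<close> of the \<open>t = S + 3\<close> conditions are counted in this way, the hypothesis on \<open>q\<close> leaves enough room
  to replace Weil's bound for the character sums by the weaker \<open>2 k S \<surd>q + S\<close>, which Stepanov's method
  gives without passing to extension fields.
\<close>

subsection \<open>Roots of unity and finite fields\<close>

text \<open>Divisibility of exponents encodes that the order is exactly \<open>n\<close>. The same
  notion serves for \<open>z\<close> in the finite field, for its image in the algebraic closure of
  the function field, and for complex roots of unity.\<close>

definition prim_root :: "nat \<Rightarrow> 'a::field \<Rightarrow> bool" where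
  "prim_root n z \<longleftrightarrow> n > 0 \<and> (\<forall>j. z ^ j = 1 \<longleftrightarrow> n dvd j)"

lemma prim_root_nonzero: "prim_root n z \<Longrightarrow> z \<noteq> 0"
  unfolding prim_root_def by (metis dvd_refl power_0_left zero_neq_one less_not_refl)

lemma prim_root_power_eq:
  assumes "prim_root n z"
  shows "z ^ i = z ^ j \<longleftrightarrow> [i = j] (mod n)"
proof -
  have *: "z ^ i = z ^ j \<longleftrightarrow> [i = j] (mod n)" if "i \<le> j" for i j
  proof -
    have "z ^ j = z ^ i * z ^ (j - i)"
      using that by (simp flip: power_add)
    hence "z ^ i = z ^ j \<longleftrightarrow> z ^ (j - i) = 1"
      using prim_root_nonzero[OF assms] by auto
    also have "\<dots> \<longleftrightarrow> n dvd (j - i)"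
      using assms by (simp add: prim_root_def)
    also have "\<dots> \<longleftrightarrow> [i = j] (mod n)"
      using that by (metis cong_altdef_nat cong_sym_eq)
    finally show ?thesis .
  qed
  show ?thesis
    using *[of i j] *[of j i] by (metis cong_sym_eq nat_le_linear)
qed

lemma prim_root_inj:
  assumes "prim_root n z" "a \<noteq> 0"
  shows "inj_on (\<lambda>j. z ^ j * a) {..<n}"
  using assms by (auto simp: inj_on_def prim_root_power_eq cong_def)

lemma prim_root_power:
  assumes "prim_root (c * n) z"
  shows "prim_root n (z ^ c)"
proof -
  have "c > 0" using assms by (auto simp: prim_root_def)
  thus ?thesis
    using assms by (auto simp: prim_root_def simp flip: power_mult)
qed

text \<open>Both sides are monic of degree \<open>n\<close> and vanish at the \<open>n\<close>
  distinct points \<open>z ^ j * a\<close>, hence coincide.\<close>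

lemma monom_minus_const_eq_prod:
  fixes a :: "'a::field"
  assumes "prim_root n z" "a \<noteq> 0"
  shows "monom 1 n - [:a ^ n:] = (\<Prod>x\<in>(\<lambda>j. z ^ j * a) ` {..<n}. [:- x, 1:])"
proof (rule poly_eqI_degree_lead_coeff)
  let ?A = "(\<lambda>j. z ^ j * a) ` {..<n}"
  have n: "n > 0" and z: "(z ^ j) ^ n = 1" for j
    using assms by (auto simp: prim_root_def simp flip: power_mult)
  show "degree (monom 1 n - [:a ^ n:]) \<le> n"
    by (intro degree_diff_le) (auto simp: degree_monom_le)
  show "degree (\<Prod>x\<in>?A. [:- x, 1:]) \<le> n"
    using card_image_le[of "{..<n}" "\<lambda>j. z ^ j * a"]
    by (intro order.trans[OF degree_prod_sum_le]) auto
  have "card ?A = n"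
    using card_image[OF prim_root_inj[OF assms]] by simp
  have "coeff (\<Prod>x\<in>?A. [:- x, 1:]) n = 1"
    using lead_coeff_prod[of "\<lambda>x. [:- x, 1:]" ?A] \<open>card ?A = n\<close>
    by (subst (asm) degree_prod_eq_sum_degree) auto
  thus "coeff (monom 1 n - [:a ^ n:]) n = coeff (\<Prod>x\<in>?A. [:- x, 1:]) n"
    using n by (auto simp: coeff_pCons split: nat.splits)
  show "n \<le> card ?A" using \<open>card ?A = n\<close> by simp
  show "poly (monom 1 n - [:a ^ n:]) x = poly (\<Prod>x\<in>?A. [:- x, 1:]) x" if "x \<in> ?A" for x
    using that by (auto simp: poly_monom power_mult_distrib z poly_prod)
qed

lemma prim_root_cover:
  assumes "prim_root n z" "x ^ n = 1"
  shows "\<exists>j<n. x = z ^ j"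
proof -
  have "poly (monom 1 n - [:1 ^ n:]) x = 0"
    using assms by (simp add: poly_monom)
  thus ?thesis
    by (subst (asm) monom_minus_const_eq_prod[OF assms(1)]) (auto simp: poly_prod)
qed

lemma sum_prim_root:
  assumes "prim_root n z"
  shows "(\<Sum>j<n. z ^ (j * l)) = (if n dvd l then of_nat n else 0)"
proof (cases "n dvd l")
  case True
  hence "z ^ (j * l) = 1" for j
    using assms by (simp add: prim_root_def)
  thus ?thesis using True by simp
next
  case False
  hence "z ^ l \<noteq> 1"
    using assms by (simp add: prim_root_def)
  have "(\<Sum>j<n. z ^ (j * l)) = (\<Sum>j<n. (z ^ l) ^ j)"
    by (simp add: mult.commute flip: power_mult)
  also have "\<dots> = ((z ^ l) ^ n - 1) / (z ^ l - 1)"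
    using geometric_sum[OF \<open>z ^ l \<noteq> 1\<close>] by simp
  also have "(z ^ l) ^ n = 1"
    using assms by (simp add: prim_root_def flip: power_mult)
  finally show ?thesis using False by simp
qed

section \<open>Powers of the field order \<open>q\<close> in the field and in its polynomial
  ring\<close>

lemma finite_field_power_card_minus_1:
  fixes x :: "'a::{finite,field}"
  assumes "x \<noteq> 0"
  shows "x ^ (CARD('a) - 1) = 1"
proof -
  have "(\<Prod>y\<in>UNIV - {0::'a}. y) = (\<Prod>y\<in>UNIV - {0}. x * y)"
    by (rule prod.reindex_bij_witness[of _ "\<lambda>y. x * y" "\<lambda>y. y / x"]) (use assms in auto)
  also have "\<dots> = x ^ (CARD('a) - 1) * (\<Prod>y\<in>UNIV - {0}. y)"
    by (simp add: prod.distrib card_Diff_singleton)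
  finally show ?thesis by (simp add: prod_zero_iff)
qed

lemma card_field_ge_2: "CARD('a::{finite,field}) \<ge> 2"
  using card_mono[of "UNIV" "{0,1::'a}"] by simp

lemma finite_field_power_card:
  fixes x :: "'a::{finite,field}"
  shows "x ^ CARD('a) = x"
proof (cases "x = 0")
  case False
  have "x ^ CARD('a) = x ^ (CARD('a) - 1) * x"
    using card_field_ge_2[where 'a='a] by (simp flip: power_Suc2)
  thus ?thesis using finite_field_power_card_minus_1[OF False] by simp
qed auto

lemma monom_card_eq_prod:
  "monom 1 CARD('a) - [:0, 1:] = (\<Prod>a\<in>UNIV. [:- a, 1 :: 'a::{finite,field}:])"
proof (rule poly_eqI_degree_lead_coeff[of _ "CARD('a)" _ UNIV])
  let ?n = "CARD('a)"
  show "degree (monom 1 ?n - [:0, 1::'a:]) \<le> ?n"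
    using card_field_ge_2[where 'a='a] by (intro degree_diff_le) (auto simp: degree_monom_le)
  show "degree (\<Prod>a\<in>UNIV. [:- a, 1 :: 'a:]) \<le> ?n"
    by (intro order.trans[OF degree_prod_sum_le]) auto
  have "coeff (\<Prod>a\<in>UNIV. [:- a, 1 :: 'a:]) ?n = 1"
    using lead_coeff_prod[of "\<lambda>x. [:- x, 1 :: 'a:]" UNIV]
    by (subst (asm) degree_prod_eq_sum_degree) auto
  thus "coeff (monom 1 ?n - [:0, 1::'a:]) ?n = coeff (\<Prod>a\<in>UNIV. [:- a, 1 :: 'a:]) ?n"
    using card_field_ge_2[where 'a='a] by (auto simp: coeff_pCons split: nat.splits)
  show "CARD('a) \<le> card (UNIV :: 'a set)" by simp
  show "poly (monom 1 ?n - [:0, 1::'a:]) x = poly (\<Prod>a\<in>UNIV. [:- a, 1 :: 'a:]) x" for x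
    by (simp add: poly_monom poly_prod finite_field_power_card prod_zero_iff)
qed

lemma pcompose_power: "pcompose (p ^ n) r = pcompose p r ^ n"
  for p r :: "'a::comm_semiring_1 poly"
  by (induction n) (auto simp: pcompose_mult pcompose_1)

text \<open>The roots of \<open>X^q - X\<close> form the whole field, so substituting
  \<open>X - y\<close> for \<open>X\<close> only permutes its linear factors. Equating the two forms
  isolates \<open>(X - y)^q\<close>.\<close>

lemma linear_power_card:
  fixes y :: "'a::{finite,field}"
  shows "[:- y, 1:] ^ CARD('a) = monom 1 CARD('a) - [:y:]"
proof -
  have "pcompose (monom 1 CARD('a) - [:0, 1:]) [:- y, 1:] = (\<Prod>a\<in>UNIV. [:- (y + a), 1:])"
    by (simp add: monom_card_eq_prod pcompose_prod pcompose_pCons algebra_simps)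
  also have "\<dots> = (\<Prod>a\<in>UNIV. [:- a, 1:])"
    by (rule prod.reindex_bij_witness[of _ "\<lambda>a. a - y" "\<lambda>a. y + a"]) auto
  also have "\<dots> = monom 1 CARD('a) - [:0, 1:]"
    by (simp add: monom_card_eq_prod)
  finally have "monom 1 CARD('a) - [:0, 1:] = [:- y, 1:] ^ CARD('a) - [:- y, 1:]"
    by (simp add: pcompose_diff monom_altdef pcompose_power pcompose_pCons)
  hence "[:- y, 1:] ^ CARD('a) = monom 1 CARD('a) - [:0, 1:] + [:- y, 1:]"
    unfolding eq_diff_eq by (rule sym)
  also have "\<dots> = monom 1 CARD('a) - ([:0, 1:] - [:- y, 1:])"
    by (simp only: diff_diff_eq2 diff_add_eq)
  also have "[:0, 1:] - [:- y, 1:] = [:y:]" by simp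
  finally show ?thesis .
qed

text \<open>The difference of the two sides is exactly \<open>(X - y)^q\<close>. This congruence and
  the next turn \<open>q\<close>-th powers into constants, which makes high orders of vanishing at
  \<open>y\<close> computable in Stepanov's method.\<close>

lemma monom_card_cong:
  fixes y :: "'a::{finite,field}"
  shows "[monom 1 CARD('a) = [:y:]] (mod [:- y, 1:] ^ CARD('a))"
  by (simp add: cong_iff_dvd_diff linear_power_card)

lemma linear_power_card_cong:
  fixes d y :: "'a::{finite,field}"
  shows "[[:- d, 1:] ^ CARD('a) = [:y - d:]] (mod [:- y, 1:] ^ CARD('a))"
proof -
  have "[:- d, 1:] ^ CARD('a) - [:y - d:] = [:- y, 1:] ^ CARD('a)"
    by (simp add: linear_power_card)
  thus ?thesis by (simp add: cong_iff_dvd_diff)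
qed

text \<open>Every element of \<open>A\<close> is a root of \<open>G\<close> or of the cofactor
  \<open>K\<close>, and the two degrees add up to \<open>card A\<close>, so \<open>G\<close> has as
  many roots in \<open>A\<close> as its degree.\<close>

lemma monic_dvd_prod_linear:
  fixes G :: "'a::field poly"
  assumes "finite A" "lead_coeff G = 1" "G dvd (\<Prod>x\<in>A. [:- x, 1:])"
  shows "\<exists>B\<subseteq>A. card B = degree G \<and> G = (\<Prod>x\<in>B. [:- x, 1:])"
proof -
  define B where "B = {x \<in> A. poly G x = 0}"
  obtain K where K: "(\<Prod>x\<in>A. [:- x, 1:]) = G * K" using assms(3) by blast
  have nz: "(\<Prod>x\<in>A. [:- x, 1:]) \<noteq> 0" using assms(1) by simp
  hence nz': "G \<noteq> 0" "K \<noteq> 0" using K by auto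
  have deg: "degree G + degree K = card A"
    using degree_mult_eq[OF nz'] K degree_prod_eq_sum_degree[of A "\<lambda>x. [:- x, 1:]"] by simp
  have "A \<subseteq> {x. poly G x = 0} \<union> {x. poly K x = 0}"
  proof
    fix x assume "x \<in> A"
    hence "poly (G * K) x = 0" using assms(1) by (simp flip: K add: poly_prod)
    thus "x \<in> {x. poly G x = 0} \<union> {x. poly K x = 0}" by auto
  qed
  hence "A \<subseteq> B \<union> {x. poly K x = 0}" by (auto simp: B_def)
  hence "card A \<le> card B + card {x. poly K x = 0}"
    using nz' assms(1) by (intro order.trans[OF card_mono card_Un_le]) (auto simp: B_def poly_roots_finite)
  hence "degree G \<le> card B"
    using card_poly_roots_bound[OF nz'(2)] deg by linarith
  moreover have "card B \<le> card {x. poly G x = 0}"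
    using nz' by (intro card_mono) (auto simp: B_def poly_roots_finite)
  ultimately have cB: "card B = degree G"
    using card_poly_roots_bound[OF nz'(1)] by linarith
  have finB: "finite B" using assms(1) by (simp add: B_def)
  have dB: "degree (\<Prod>x\<in>B. [:- x, 1:]) = card B"
    by (subst degree_prod_eq_sum_degree) auto
  have "G = (\<Prod>x\<in>B. [:- x, 1:])"
  proof (rule poly_eqI_degree_lead_coeff[of _ "card B" _ B])
    show "coeff G (card B) = coeff (\<Prod>x\<in>B. [:- x, 1:]) (card B)"
      using lead_coeff_prod[of "\<lambda>x. [:- x, 1:]" B] assms(2) by (simp add: cB dB)
  qed (use finB cB dB in \<open>auto simp: B_def poly_prod\<close>)
  thus ?thesis using cB by (intro exI[of _ B]) (auto simp: B_def)
qed

subsection \<open>Linear independence of radicals\<close>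

text \<open>Three embeddings are used: polynomials into rational functions, a field into its
  algebraic closure, and polynomials into the algebraic closure of the rational functions.\<close>

locale inj_ring_hom =
  fixes h :: "'a::idom \<Rightarrow> 'b::idom"
  assumes hom_add: "h (x + y) = h x + h y"
    and hom_mult: "h (x * y) = h x * h y"
    and hom_1: "h 1 = 1"
    and hom_eq_0: "h x = 0 \<Longrightarrow> x = 0"
begin

lemma hom_0: "h 0 = 0"
  by (metis add.right_neutral add_left_cancel hom_add)

lemma hom_power: "h (x ^ n) = h x ^ n"
  by (induction n) (auto simp: hom_1 hom_mult)

lemma hom_sum: "h (sum f A) = (\<Sum>x\<in>A. h (f x))"
  by (induction A rule: infinite_finite_induct) (auto simp: hom_0 hom_add)

lemma map_poly_hom_add: "map_poly h (p + q) = map_poly h p + map_poly h q"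
  by (rule poly_eqI) (simp add: coeff_map_poly hom_0 hom_add)

lemma map_poly_hom_mult: "map_poly h (p * q) = map_poly h p * map_poly h q"
  by (rule poly_eqI) (simp add: coeff_map_poly hom_0 coeff_mult hom_sum hom_mult)

lemma map_poly_hom_prod: "map_poly h (prod f A) = (\<Prod>x\<in>A. map_poly h (f x))"
  by (induction A rule: infinite_finite_induct) (auto simp: map_poly_hom_mult map_poly_1' hom_1)

lemma map_poly_hom_eq_0: "map_poly h p = 0 \<longleftrightarrow> p = 0"
  by (auto simp: poly_eq_iff coeff_map_poly hom_0 dest: hom_eq_0)

lemma degree_map_poly_hom: "degree (map_poly h p) = degree p"
  by (rule degree_map_poly) (auto dest: hom_eq_0)

lemma poly_map_poly_pcompose_scale:
  "poly (map_poly h (pcompose p [:0, b:])) x = poly (map_poly h p) (h b * x)"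
proof (induction p)
  case (pCons a p)
  have map_lin: "map_poly h [:0, b:] = [:0, h b:]" "map_poly h [:a:] = [:h a:]"
    "map_poly h (pCons a p) = pCons (h a) (map_poly h p)" for a p
    by (simp_all add: map_poly_pCons hom_0)
  show ?case using pCons.IH
    by (simp only: pcompose_pCons map_poly_hom_add map_poly_hom_mult map_lin poly_add poly_mult)
      (simp add: algebra_simps hom_0)
qed simp

end

interpretation to_fract_hom: inj_ring_hom "to_fract :: 'a::idom \<Rightarrow> 'a fract"
  by standard auto

interpretation to_ac_hom: inj_ring_hom "to_ac :: 'a::field \<Rightarrow> 'a alg_closure"
  by standard auto

interpretation to_fract_ac_hom:
  inj_ring_hom "\<lambda>p :: 'a::field poly. to_ac (to_fract p)"
  by standard auto

section \<open>Minimal polynomials and norms of radicals\<close>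

lemma order_power:
  fixes p :: "'a::idom poly"
  assumes "p \<noteq> 0"
  shows "order x (p ^ n) = n * order x p"
  using assms by (induction n) (auto simp: order_mult)

lemma poly_eq_sum_less:
  fixes p :: "'a::comm_semiring_1 poly"
  assumes "degree p < n"
  shows "poly p x = (\<Sum>i<n. coeff p i * x ^ i)"
proof -
  have "(\<Sum>i\<le>degree p. coeff p i * x ^ i) = (\<Sum>i<n. coeff p i * x ^ i)"
    using assms by (intro sum.mono_neutral_left) (auto simp: coeff_eq_0)
  thus ?thesis by (simp add: poly_altdef)
qed

text \<open>An annihilating polynomial of least degree, made monic, is the minimal polynomial of
  \<open>\<delta>\<close>; division with remainder shows that it divides every other one.\<close>

lemma min_degree_root_poly:
  fixes \<delta> :: "'a::field alg_closure"
  assumes "P \<noteq> 0" "poly (map_poly to_ac P) \<delta> = 0"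
  obtains G where "lead_coeff G = 1" "degree G > 0" "degree G \<le> degree P"
    "\<And>Q. poly (map_poly to_ac Q) \<delta> = 0 \<Longrightarrow> G dvd Q"
proof -
  define S where "S = {G. G \<noteq> 0 \<and> poly (map_poly to_ac G) \<delta> = 0}"
  obtain H where H: "H \<in> S" "\<And>G. G \<in> S \<Longrightarrow> degree H \<le> degree G"
    using ex_has_least_nat[of "\<lambda>G. G \<in> S" P degree] assms by (auto simp: S_def)
  have H': "H \<noteq> 0" "poly (map_poly to_ac H) \<delta> = 0" using H by (auto simp: S_def)
  define G where "G = [:inverse (lead_coeff H):] * H"
  have G0: "G \<noteq> 0" using H' by (simp add: G_def)
  have root: "poly (map_poly to_ac G) \<delta> = 0"
    using H' unfolding G_def to_ac_hom.map_poly_hom_mult by simp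
  have deg: "degree G = degree H" using H' by (simp add: G_def)
  show ?thesis
  proof (rule that)
    show "lead_coeff G = 1" using H' by (simp add: G_def)
    show "degree G > 0"
    proof (rule ccontr)
      assume "\<not> degree G > 0"
      then obtain c where c: "G = [:c:]" by (metis gr0I degree_eq_zeroE)
      thus False using root G0 by (simp add: map_poly_pCons)
    qed
    show "degree G \<le> degree P"
      using H(2)[of P] assms deg by (simp add: S_def)
    show "G dvd Q" if Q: "poly (map_poly to_ac Q) \<delta> = 0" for Q
    proof (rule ccontr)
      assume ndvd: "\<not> G dvd Q"
      have "map_poly to_ac Q = map_poly to_ac (Q div G) * map_poly to_ac G + map_poly to_ac (Q mod G)"
        by (simp flip: to_ac_hom.map_poly_hom_mult to_ac_hom.map_poly_hom_add)
      hence "poly (map_poly to_ac (Q mod G)) \<delta> = 0" using Q root by simp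
      hence "degree H \<le> degree (Q mod G)"
        using H(2) ndvd by (auto simp: S_def mod_eq_0_iff_dvd)
      thus False using degree_mod_less_degree[OF G0 ndvd] deg by simp
    qed
  qed
qed

text \<open>
  Kummer theory by hand: the constant coefficient of the minimal polynomial of a \<open>k\<close>-th root
  of \<open>c / f\<close> is, up to a root of unity, a power of that root with exponent the degree.
\<close>

lemma radical_degree:
  fixes f :: "'a::field poly" and z c :: 'a
  assumes z: "prim_root k z" and f: "f \<noteq> 0" and c: "c \<noteq> 0"
    and ord: "\<And>d. (\<And>x. k dvd d * order x f) \<Longrightarrow> k dvd d"
    and \<delta>: "\<delta> ^ k = to_ac (to_fract [:c:] / to_fract f)"
    and P: "P \<noteq> 0" "poly (map_poly to_ac P) \<delta> = 0"
  shows "k \<le> degree P"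
proof (rule ccontr)
  assume less: "\<not> k \<le> degree P"
  obtain G where G: "lead_coeff G = 1" "degree G > 0" "degree G \<le> degree P"
    "\<And>Q. poly (map_poly to_ac Q) \<delta> = 0 \<Longrightarrow> G dvd Q"
    using min_degree_root_poly[OF P] by metis
  define u where "u = to_fract [:c:] / to_fract f"
  define d where "d = degree G"
  have k: "k > 0" using z by (simp add: prim_root_def)
  have u0: "u \<noteq> 0" using c f by (simp add: u_def)
  have \<delta>0: "\<delta> \<noteq> 0"
    using \<delta> k u0 unfolding u_def by (metis power_eq_0_iff to_ac_eq_0_iff)
  define Z where "Z = to_ac (to_fract [:z:])"
  have Zpow: "Z ^ j = to_ac (to_fract [:z ^ j:])" for j
    by (simp add: Z_def to_fract_hom.hom_power flip: to_ac_power poly_const_pow)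
  have "to_fract [:w:] = 1 \<longleftrightarrow> w = 1" for w :: 'a
  proof -
    have "to_fract [:w:] = 1 \<longleftrightarrow> [:w:] = 1" by (metis to_fract_1 to_fract_eq_iff)
    thus ?thesis by (simp add: one_pCons)
  qed
  hence Z: "prim_root k Z"
    using z unfolding prim_root_def Zpow to_ac_eq_1_iff by simp
  let ?A = "(\<lambda>j. Z ^ j * \<delta>) ` {..<k}"
  \<comment> \<open>Over the algebraic closure \<open>X^k - u\<close> is
    \<open>X^k - \<delta>^k\<close> and splits with roots \<open>Z ^ j * \<delta>\<close>, so the
    roots of \<open>G\<close> are among these.\<close>
  have mapQ: "map_poly to_ac (monom 1 k + [:- u:]) = monom 1 k - [:\<delta> ^ k:]"
    by (simp add: to_ac_hom.map_poly_hom_add map_poly_monom map_poly_pCons \<delta> u_def)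
  have "G dvd monom 1 k + [:- u:]"
    by (rule G(4)) (simp add: mapQ poly_monom)
  hence "map_poly to_ac G dvd map_poly to_ac (monom 1 k + [:- u:])"
    by (auto simp: to_ac_hom.map_poly_hom_mult elim!: dvdE)
  hence "map_poly to_ac G dvd (\<Prod>x\<in>?A. [:- x, 1:])"
    by (simp only: mapQ monom_minus_const_eq_prod[OF Z \<delta>0])
  then obtain B where B: "B \<subseteq> ?A" "card B = d" "map_poly to_ac G = (\<Prod>x\<in>B. [:- x, 1:])"
    using monic_dvd_prod_linear[of ?A "map_poly to_ac G"] G(1)
    by (auto simp: to_ac_hom.degree_map_poly_hom coeff_map_poly d_def)
  \<comment> \<open>The constant coefficient is a product of \<open>d\<close> negated roots, each
    with \<open>k\<close>-th power \<open>u\<close>; hence its own \<open>k\<close>-th power is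
    \<open>u ^ d\<close> up to sign.\<close>
  have "to_ac (coeff G 0) = (\<Prod>x\<in>B. - x)"
    using arg_cong[OF B(3), of "\<lambda>p. poly p 0"]
    by (simp add: poly_prod) (simp add: poly_0_coeff_0 coeff_map_poly)
  hence "to_ac (coeff G 0) ^ k = (\<Prod>x\<in>B. (- x) ^ k)"
    by (simp add: prod_power_distrib)
  also have "\<dots> = (\<Prod>x\<in>B. (- 1) ^ k * to_ac u)"
  proof (rule prod.cong)
    fix x assume "x \<in> B"
    then obtain j where "x = Z ^ j * \<delta>" using B(1) by auto
    moreover have "(Z ^ j) ^ k = 1"
      using Z by (simp add: prim_root_def flip: power_mult)
    ultimately have "x ^ k = to_ac u" by (simp add: power_mult_distrib \<delta> u_def)
    thus "(- x) ^ k = (- 1) ^ k * to_ac u" by (metis power_minus)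
  qed auto
  also have "\<dots> = to_ac (((- 1) ^ k * u) ^ d)"
    by (simp add: B(2))
  finally have eq: "coeff G 0 ^ k = ((- 1) ^ k * u) ^ d"
    by (simp flip: to_ac_power)
  \<comment> \<open>Written with a fraction \<open>a / b\<close>, the equation makes
    \<open>a ^ k * f ^ d\<close> a constant multiple of \<open>b ^ k\<close>. Comparing orders at
    \<open>x\<close> leaves \<open>d * order x f\<close> divisible by \<open>k\<close>.\<close>
  obtain a b where ab: "coeff G 0 = to_fract a / to_fract b" "b \<noteq> 0"
    by (metis Fract_cases Fract_conv_to_fract)
  have "[:((- 1) ^ k * c) ^ d:] = ((- 1) ^ k * [:c:]) ^ d"
    by (simp add: poly_const_pow[symmetric] mult.commute[of _ "[:c:]"])
      (simp add: poly_const_pow one_pCons mult.commute)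
  hence rhs: "to_fract ([:((- 1) ^ k * c) ^ d:] * b ^ k) = ((- 1) ^ k * to_fract [:c:]) ^ d * to_fract b ^ k"
    by (simp only: to_fract_mult to_fract_hom.hom_power to_fract_uminus to_fract_1)
  have "to_fract (a ^ k * f ^ d) = to_fract ([:((- 1) ^ k * c) ^ d:] * b ^ k)"
    unfolding rhs using eq ab f
    by (simp add: u_def to_fract_hom.hom_power power_divide power_mult_distrib field_simps)
  hence "a ^ k * f ^ d = [:((- 1) ^ k * c) ^ d:] * b ^ k"
    by (simp only: to_fract_eq_iff)
  hence eq': "a ^ k * f ^ d = smult (((- 1) ^ k * c) ^ d) (b ^ k)" by simp
  have a0: "a \<noteq> 0" using eq' ab(2) c f k by (auto simp: power_0_left)
  have "k dvd d * order x f" for x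
  proof -
    have "k * order x a + d * order x f = k * order x b"
      using arg_cong[OF eq', of "order x"] a0 f ab(2) c
      by (simp add: order_mult order_power order_smult)
    thus ?thesis by (metis dvd_triv_left dvd_add_right_iff)
  qed
  hence "k dvd d" by (rule ord)
  thus False using G less by (auto simp: d_def dest!: dvd_imp_le)
qed

text \<open>Replacing the variable by \<open>z\<close> times itself permutes the \<open>k\<close>
  factors cyclically, because \<open>z ^ k = 1\<close>. Hence \<open>z ^ i\<close> fixes the
  \<open>i\<close>-th coefficient, which kills all degrees not divisible by
  \<open>k\<close>.\<close>

lemma twisted_norm:
  fixes P :: "'a::field poly poly" and z :: 'a
  assumes z: "prim_root k z" and degP: "degree P < k"
    and N: "N = (\<Prod>j<k. pcompose P [:0, [:z ^ j:]:])"
  shows "degree N < k * k" "\<not> k dvd i \<Longrightarrow> coeff N i = 0"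
proof -
  have k: "k > 0" using z by (simp add: prim_root_def)
  have N_shift: "pcompose N [:0, [:z:]:] = N"
  proof -
    have "pcompose N [:0, [:z:]:] = (\<Prod>j<k. pcompose P [:0, [:z ^ Suc j:]:])"
      by (simp add: N pcompose_prod pcompose_assoc[symmetric] pcompose_pCons mult.commute)
    also have "\<dots> = (\<Prod>j<k. pcompose P [:0, [:z ^ j:]:])"
    proof -
      obtain k' where k': "k = Suc k'" using k by (cases k) auto
      have "z ^ k = 1" using z by (simp add: prim_root_def)
      thus ?thesis
        unfolding k' by (subst prod.lessThan_Suc, subst prod.lessThan_Suc_shift)
          (simp add: mult.commute)
    qed
    finally show ?thesis by (simp add: N)
  qed
  show "coeff N i = 0" if "\<not> k dvd i"
  proof -
    have "[:z ^ i:] * coeff N i = coeff N i"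
      using arg_cong[OF N_shift, of "\<lambda>p. coeff p i"]
      by (simp add: coeff_pcompose_linear poly_const_pow)
    hence "smult (z ^ i - 1) (coeff N i) = 0" by (simp add: smult_diff_left)
    moreover have "z ^ i \<noteq> 1" using that z by (simp add: prim_root_def)
    ultimately show ?thesis by simp
  qed
  have "degree N \<le> (\<Sum>j<k. k - 1)"
    unfolding N
  proof (rule order.trans[OF degree_prod_sum_le[OF finite_lessThan]], rule sum_mono)
    fix j
    have "degree (pcompose P [:0, [:z ^ j:]:]) \<le> degree P * 1"
      by (rule order.trans[OF degree_pcompose_le]) (auto intro!: mult_left_mono)
    thus "(degree \<circ> (\<lambda>j. pcompose P [:0, [:z ^ j:]:])) j \<le> k - 1" using degP by simp
  qed
  also have "\<dots> < k * k" using k by simp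
  finally show "degree N < k * k" .
qed

lemma poly_eq_sum_multiples:
  fixes p :: "'a::comm_semiring_1 poly"
  assumes "degree p < k * k" "\<And>i. \<not> k dvd i \<Longrightarrow> coeff p i = 0"
  shows "poly p x = (\<Sum>l<k. coeff p (k * l) * (x ^ k) ^ l)"
proof -
  have k: "k > 0" using assms(1) by (auto intro: Nat.gr0I)
  have "poly p x = (\<Sum>i<k * k. coeff p i * x ^ i)"
    by (rule poly_eq_sum_less[OF assms(1)])
  also have "\<dots> = (\<Sum>i\<in>(\<lambda>l. k * l) ` {..<k}. coeff p i * x ^ i)"
  proof (intro sum.mono_neutral_right ballI)
    fix i assume i: "i \<in> {..<k * k} - (\<lambda>l. k * l) ` {..<k}"
    hence "\<not> k dvd i" by (auto elim!: dvdE)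
    thus "coeff p i * x ^ i = 0" by (simp add: assms(2))
  qed (use k in auto)
  also have "\<dots> = (\<Sum>l<k. coeff p (k * l) * (x ^ k) ^ l)"
    using k by (subst sum.reindex) (auto simp: inj_on_def power_mult)
  finally show ?thesis .
qed

text \<open>For a radical \<open>\<delta>\<close> with \<open>\<delta>^k = c / f\<close>, the sum in
  \<open>norm\<close> is the value of \<open>N\<close> at \<open>\<delta>\<close> times
  \<open>f ^ (k - 1)\<close>. If it is zero, one factor of \<open>N\<close> vanishes, so some
  \<open>k\<close>-th root of \<open>c / f\<close> is a root of \<open>P\<close>; by
  \<open>radical_degree\<close> a nonzero \<open>P\<close> of degree below \<open>k\<close> has no
  such root.\<close>

lemma radical_norm_eq_0:
  fixes P :: "'a::field poly poly" and z c :: 'a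
  assumes z: "prim_root k z" and f: "f \<noteq> 0" and c: "c \<noteq> 0"
    and ord: "\<And>d. (\<And>x. k dvd d * order x f) \<Longrightarrow> k dvd d"
    and degP: "degree P < k"
    and N: "N = (\<Prod>j<k. pcompose P [:0, [:z ^ j:]:])"
    and norm: "(\<Sum>l<k. coeff N (k * l) * f ^ (k - 1 - l) * [:c ^ l:]) = 0"
  shows "P = 0"
proof (rule ccontr)
  assume P0: "P \<noteq> 0"
  let ?h = "\<lambda>p :: 'a poly. to_ac (to_fract p)"
  have k: "k > 0" using z by (simp add: prim_root_def)
  obtain \<delta> where \<delta>: "\<delta> ^ k = to_ac (to_fract [:c:] / to_fract f)"
    using nth_root_exists[OF k] by blast
  have "poly (map_poly ?h N) \<delta> = (\<Sum>l<k. ?h (coeff N (k * l)) * (?h [:c:] / ?h f) ^ l)"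
    using twisted_norm[OF z degP N] \<delta>
    by (subst poly_eq_sum_multiples[of _ k])
      (auto simp: to_fract_ac_hom.degree_map_poly_hom coeff_map_poly)
  hence "?h f ^ (k - 1) * poly (map_poly ?h N) \<delta> =
      (\<Sum>l<k. ?h f ^ (k - 1) * (?h (coeff N (k * l)) * (?h [:c:] / ?h f) ^ l))"
    by (simp add: sum_distrib_left)
  also have "\<dots> = (\<Sum>l<k. ?h (coeff N (k * l) * f ^ (k - 1 - l) * [:c ^ l:]))"
  proof (rule sum.cong)
    fix l assume "l \<in> {..<k}"
    hence "?h f ^ (k - 1) = ?h f ^ (k - 1 - l) * ?h f ^ l" by (simp flip: power_add)
    moreover have "?h f \<noteq> 0" using f by simp
    ultimately show "?h f ^ (k - 1) * (?h (coeff N (k * l)) * (?h [:c:] / ?h f) ^ l) =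
        ?h (coeff N (k * l) * f ^ (k - 1 - l) * [:c ^ l:])"
      by (simp add: power_divide to_fract_hom.hom_power del: to_fract_mult flip: poly_const_pow)
        (simp add: to_fract_hom.hom_power field_simps)
  qed auto
  also have "\<dots> = ?h (\<Sum>l<k. coeff N (k * l) * f ^ (k - 1 - l) * [:c ^ l:])"
    by (rule to_fract_ac_hom.hom_sum[symmetric])
  also have "\<dots> = 0" by (simp only: norm to_fract_0 to_ac_0)
  finally have "poly (map_poly ?h N) \<delta> = 0" using f by simp
  hence "(\<Prod>j<k. poly (map_poly ?h P) (?h [:z ^ j:] * \<delta>)) = 0"
    by (simp add: N to_fract_ac_hom.map_poly_hom_prod poly_prod
        to_fract_ac_hom.poly_map_poly_pcompose_scale)
  then obtain j where j: "poly (map_poly ?h P) (?h [:z ^ j:] * \<delta>) = 0" by auto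
  have "[:z ^ j:] ^ k = 1"
    using z by (simp add: poly_const_pow prim_root_def one_pCons flip: power_mult)
  hence "?h [:z ^ j:] ^ k = 1"
    by (simp add: to_fract_hom.hom_power[symmetric] flip: to_ac_power)
  hence "(?h [:z ^ j:] * \<delta>) ^ k = to_ac (to_fract [:c:] / to_fract f)"
    by (simp add: power_mult_distrib \<delta>)
  moreover have "poly (map_poly to_ac (map_poly to_fract P)) (?h [:z ^ j:] * \<delta>) = 0"
    using j by (simp add: map_poly_map_poly o_def)
  ultimately have "k \<le> degree (map_poly to_fract P)"
    using radical_degree[OF z f c ord] P0 by (simp add: to_fract_hom.map_poly_hom_eq_0)
  thus False using degP by (simp add: to_fract_hom.degree_map_poly_hom)
qed

subsection \<open>Stepanov's auxiliary polynomials\<close>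

lemma order_prod_linear:
  assumes "finite A"
  shows "order x (\<Prod>d\<in>A. [:- d, 1 :: 'a::field:] ^ n d) = (if x \<in> A then n x else 0)"
  using assms
proof (induction A rule: finite_induct)
  case (insert d A)
  have "order x ([:- d, 1:] ^ n d) = (if x = d then n d else 0)"
    by (auto simp: order_power_n_n order_0I)
  thus ?case using insert by (auto simp: order_mult)
qed simp

lemma degree_prod_linear:
  "degree (\<Prod>d\<in>A. [:- d, 1 :: 'a::field:] ^ n d) = (\<Sum>d\<in>A. n d)"
  by (subst degree_prod_eq_sum_degree) (auto simp: degree_power_eq)

lemma degree_coeff_mult_le:
  fixes p q :: "'a::comm_ring_1 poly poly"
  assumes "\<And>i. degree (coeff p i) \<le> a" "\<And>i. degree (coeff q i) \<le> b"
  shows "degree (coeff (p * q) i) \<le> a + b"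
  unfolding coeff_mult
  by (intro degree_sum_le order.trans[OF degree_mult_le] add_mono assms) auto

lemma degree_coeff_prod_le:
  fixes p :: "'b \<Rightarrow> 'a::comm_ring_1 poly poly"
  assumes "finite S" "\<And>j i. j \<in> S \<Longrightarrow> degree (coeff (p j) i) \<le> a"
  shows "degree (coeff (prod p S) i) \<le> card S * a"
  using assms
proof (induction S arbitrary: i rule: finite_induct)
  case (insert j S)
  thus ?case by (auto intro!: degree_coeff_mult_le)
qed (auto simp: coeff_1)

lemma prod_linear_power_card_cong:
  fixes y :: "'a::{finite,field}"
  shows "[(\<Prod>d\<in>A. [:- d, 1:] ^ n d) ^ CARD('a) = [:\<Prod>d\<in>A. (y - d) ^ n d:]]
    (mod [:- y, 1:] ^ CARD('a))"
proof -
  have "[(\<Prod>d\<in>A. ([:- d, 1:] ^ CARD('a)) ^ n d) = (\<Prod>d\<in>A. [:y - d:] ^ n d)]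
    (mod [:- y, 1:] ^ CARD('a))"
    by (intro cong_prod cong_pow linear_power_card_cong)
  moreover have "(\<Prod>d\<in>A. ([:- d, 1:] ^ CARD('a)) ^ n d) = (\<Prod>d\<in>A. [:- d, 1:] ^ n d) ^ CARD('a)"
    by (simp add: prod_power_distrib mult.commute flip: power_mult)
  moreover have "(\<Prod>d\<in>A. [:y - d:] ^ n d) = [:\<Prod>d\<in>A. (y - d) ^ n d:]"
    by (induction A rule: infinite_finite_induct) (auto simp: poly_const_pow one_pCons mult.commute)
  ultimately show ?thesis by simp
qed

lemma cong_dvd_0: "[a = b] (mod c) \<Longrightarrow> c dvd a \<Longrightarrow> c dvd b"
  for a b c :: "'a::unique_euclidean_ring"
  using cong_dvd_iff by blast

text \<open>
  The last assumption says that \<open>Y\<^sup>k = \<Prod>d\<in>A. (X - d)\<^bsup>m d\<^esup>\<close> is absolutely irreducible. It is weaker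
  than the existence of a single \<open>d\<close> with \<open>m d\<close> coprime to \<open>k\<close>, so that auxiliary polynomials cannot
  be shown to be nonzero by comparing degrees.
\<close>

locale stepanov =
  fixes A :: "'a::{finite,field} set" and m :: "'a \<Rightarrow> nat" and k e q :: nat and z :: 'a
  assumes q_card: "q = CARD('a)" and q_eq: "q = k * e + 1"
    and z: "prim_root k z"
    and m_less: "d \<in> A \<Longrightarrow> m d < k"
    and m_coprime: "(\<And>d. d \<in> A \<Longrightarrow> k dvd c * m d) \<Longrightarrow> k dvd c"
begin

definition f :: "'a poly" where "f = (\<Prod>d\<in>A. [:- d, 1:] ^ m d)"
text \<open>The power \<open>(f ^ e) ^ i\<close> with the exponent of every linear factor reduced
  modulo \<open>q - 1 = k * e\<close>. It agrees with that power as a function outside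
  \<open>A\<close>, and its degree is bounded independently of \<open>i\<close>.\<close>

definition w :: "nat \<Rightarrow> 'a poly" where
  "w i = (\<Prod>d\<in>A. [:- d, 1:] ^ ((i * m d mod k) * e))"
text \<open>The quotients lost in that reduction; they enter \<open>w_relation\<close> through a
  \<open>q\<close>-th power, which is constant modulo \<open>(X - y)^q\<close>.\<close>

definition v :: "nat \<Rightarrow> 'a poly" where
  "v i = (\<Prod>d\<in>A. [:- d, 1:] ^ (i * m d div k))"

lemma k_pos: "k > 0" using z by (simp add: prim_root_def)

lemma prod_cong_q:
  "[(\<Prod>d\<in>B. [:- d, 1:] ^ n d) ^ q = [:\<Prod>d\<in>B. (y - d) ^ n d:]] (mod [:- y, 1 :: 'a:] ^ q)"
  unfolding q_card by (rule prod_linear_power_card_cong)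

lemma monom_cong_q: "[monom 1 q = [:y:]] (mod [:- y, 1 :: 'a:] ^ q)"
  unfolding q_card by (rule monom_card_cong)

lemma w_relation: "v i * (f ^ e) ^ i = w i * v i ^ q"
proof -
  \<comment> \<open>With \<open>i * m d = k * a + b\<close> this reads
    \<open>a + (k * a + b) * e = b * e + a * (k * e + 1)\<close>.\<close>
  have exp: "i * m d div k + m d * (e * i) = (i * m d mod k) * e + (i * m d div k) * q" for d
  proof -
    define a b where "a = i * m d div k" and "b = i * m d mod k"
    have "i * m d = k * a + b" by (simp add: a_def b_def)
    hence "m d * (e * i) = (k * a + b) * e" by (simp add: ac_simps)
    thus ?thesis unfolding a_def[symmetric] b_def[symmetric] q_eq by (simp add: algebra_simps)
  qed
  have "v i * (f ^ e) ^ i = (\<Prod>d\<in>A. [:- d, 1:] ^ (i * m d div k + m d * (e * i)))"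
    by (simp add: v_def f_def prod_power_distrib prod.distrib power_add mult.assoc flip: power_mult)
  also have "\<dots> = w i * v i ^ q"
    by (simp add: exp v_def w_def prod_power_distrib prod.distrib power_add flip: power_mult)
  finally show ?thesis .
qed

lemma degree_f: "degree f \<le> card A * (k - 1)"
  unfolding f_def degree_prod_linear using sum_bounded_above[of A m "k - 1"] m_less by fastforce

lemma degree_v:
  assumes "i < k"
  shows "degree (v i) \<le> card A * (k - 1)"
proof -
  have "i * m d div k \<le> k - 1" if "d \<in> A" for d
  proof -
    have "i * m d \<le> (k - 1) * k"
      using assms m_less[OF that] by (intro mult_mono) auto
    thus ?thesis using div_le_mono[of "i * m d" "(k - 1) * k" k] k_pos by simp
  qed
  thus ?thesis
    unfolding v_def degree_prod_linear using sum_bounded_above[of A "\<lambda>d. i * m d div k" "k - 1"] by simp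
qed

lemma degree_w: "degree (w i) \<le> card A * ((k - 1) * e)"
proof -
  have "i * m d mod k * e \<le> (k - 1) * e" for d
    using mod_less_divisor[OF k_pos, of "i * m d"] by (intro mult_right_mono) auto
  thus ?thesis
    unfolding w_def degree_prod_linear using sum_bounded_above[of A "\<lambda>d. i * m d mod k * e"] by simp
qed

text \<open>
  Modulo \<open>(X - y)\<^sup>q\<close> the power \<open>X\<^sup>q\<close> is the constant \<open>y\<close>, so \<open>f\<^sup>e\<close> behaves like a \<open>k\<close>-th root of
  \<open>f(y) / f\<close>. The norm of a combination of its powers has degree less than \<open>q\<close>, hence it vanishes
  if it is divisible by \<open>(X - y)\<^sup>q\<close>.
\<close>

lemma combination_eq_0:
  assumes y: "y \<notin> A" and H: "\<And>i. i < k \<Longrightarrow> degree (H i) \<le> D"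
    and D: "k * D + 2 * card A * k\<^sup>2 < q"
    and cong: "[(\<Sum>i<k. H i * w i) = 0] (mod [:- y, 1:] ^ q)"
    and i: "i < k"
  shows "H i = 0"
proof -
  let ?Y = "[:- y, 1:] ^ q"
  \<comment> \<open>The residues of \<open>v i ^ q\<close> and \<open>f ^ q\<close> modulo
    \<open>?Y\<close>, nonzero constants since \<open>y\<close> lies outside
    \<open>A\<close>.\<close>
  define \<gamma> where "\<gamma> i = (\<Prod>d\<in>A. (y - d) ^ (i * m d div k))" for i
  define c where "c = (\<Prod>d\<in>A. (y - d) ^ m d)"
  have \<gamma>: "\<gamma> i \<noteq> 0" and c: "c \<noteq> 0" for i
    using y by (auto simp: \<gamma>_def c_def)
  have f0: "f \<noteq> 0" by (simp add: f_def)
  \<comment> \<open>The coefficients make \<open>P\<close> at \<open>f ^ e\<close> congruent to the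
    given combination: \<open>w_relation\<close> turns \<open>v i * (f ^ e) ^ i\<close> into
    \<open>w i * v i ^ q\<close>, and \<open>v i ^ q\<close> reduces to
    \<open>\<gamma> i\<close>.\<close>
  define P where "P = (\<Sum>i<k. monom (smult (inverse (\<gamma> i)) (H i * v i)) i)"
  have coeff_P: "coeff P i = (if i < k then smult (inverse (\<gamma> i)) (H i * v i) else 0)" for i
    by (simp add: P_def coeff_sum)
  have "degree P \<le> k - 1"
    by (rule degree_le) (auto simp: coeff_P)
  hence degP: "degree P < k" using k_pos by simp
  define N where "N = (\<Prod>j<k. pcompose P [:0, [:z ^ j:]:])"
  define W where "W = f ^ e"
  have "poly P W = (\<Sum>i<k. coeff P i * W ^ i)"
    by (rule poly_eq_sum_less[OF degP])
  also have "\<dots> = (\<Sum>i<k. [:inverse (\<gamma> i):] * (H i * (w i * v i ^ q)))"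
    by (intro sum.cong) (auto simp: coeff_P W_def mult.assoc simp flip: w_relation)
  also have "[\<dots> = (\<Sum>i<k. [:inverse (\<gamma> i):] * (H i * (w i * [:\<gamma> i:])))] (mod ?Y)"
    unfolding v_def \<gamma>_def by (intro cong_sum cong_mult cong_refl prod_cong_q)
  also have "(\<Sum>i<k. [:inverse (\<gamma> i):] * (H i * (w i * [:\<gamma> i:]))) = (\<Sum>i<k. H i * w i)"
    using \<gamma> by simp
  also note cong
  finally have "?Y dvd poly P W" by (simp add: cong_0_iff)
  moreover have "poly N W = (\<Prod>j<k. poly P ([:z ^ j:] * W))"
    by (simp add: N_def poly_prod poly_pcompose mult.commute)
  moreover have "poly P W dvd (\<Prod>j<k. poly P ([:z ^ j:] * W))"
    using dvd_prodI[of "{..<k}" 0 "\<lambda>j. poly P ([:z ^ j:] * W)"] k_pos by (simp add: one_pCons)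
  ultimately have "?Y dvd f ^ (k - 1) * poly N W"
    using dvd_trans dvd_mult by metis
  \<comment> \<open>The power of \<open>f\<close> clears denominators in advance:
    \<open>f ^ l * W ^ (k * l)\<close> is \<open>(f ^ q) ^ l\<close> because
    \<open>k * e + 1 = q\<close>, and \<open>f ^ q\<close> reduces to \<open>c\<close>.\<close>
  also have "f ^ (k - 1) * poly N W = (\<Sum>l<k. f ^ (k - 1) * (coeff N (k * l) * (W ^ k) ^ l))"
    using twisted_norm[OF z degP N_def]
    by (subst poly_eq_sum_multiples[of _ k]) (auto simp: sum_distrib_left)
  also have "\<dots> = (\<Sum>l<k. coeff N (k * l) * f ^ (k - 1 - l) * (f ^ q) ^ l)"
  proof (intro sum.cong refl)
    fix l assume "l \<in> {..<k}"
    hence "f ^ (k - 1) = f ^ (k - 1 - l) * f ^ l" by (simp flip: power_add)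
    moreover have "f ^ l * (W ^ k) ^ l = (f ^ q) ^ l"
      by (simp add: W_def q_eq power_mult_distrib power_add mult_ac flip: power_mult)
    ultimately show "f ^ (k - 1) * (coeff N (k * l) * (W ^ k) ^ l) =
        coeff N (k * l) * f ^ (k - 1 - l) * (f ^ q) ^ l"
      by (simp add: mult_ac)
  qed
  finally have dvd: "?Y dvd (\<Sum>l<k. coeff N (k * l) * f ^ (k - 1 - l) * (f ^ q) ^ l)" .
  define M where "M = (\<Sum>l<k. coeff N (k * l) * f ^ (k - 1 - l) * [:c ^ l:])"
  have "[(\<Sum>l<k. coeff N (k * l) * f ^ (k - 1 - l) * (f ^ q) ^ l) =
      (\<Sum>l<k. coeff N (k * l) * f ^ (k - 1 - l) * [:c:] ^ l)] (mod ?Y)"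
    unfolding f_def c_def
    by (intro cong_sum cong_mult cong_pow cong_refl prod_cong_q)
  hence dvdM: "?Y dvd M"
    using dvd cong_dvd_0 unfolding M_def poly_const_pow by blast
  \<comment> \<open>The hypothesis on \<open>D\<close> keeps the degree of \<open>M\<close> below
    \<open>q\<close>, so divisibility by \<open>?Y\<close> forces \<open>M = 0\<close>.\<close>
  have degN: "degree (coeff N l) \<le> k * (D + card A * (k - 1))" for l
  proof -
    have "degree (coeff (pcompose P [:0, [:z ^ j:]:]) i) \<le> D + card A * (k - 1)" for i j
      using degree_v[of i] H[of i]
      by (auto simp: coeff_pcompose_linear coeff_P poly_const_pow
          intro!: order.trans[OF degree_smult_le] order.trans[OF degree_mult_le] add_mono)
    thus ?thesis
      unfolding N_def using degree_coeff_prod_le[of "{..<k}"] by (metis card_lessThan finite_lessThan)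
  qed
  have "degree M \<le> k * (D + card A * (k - 1)) + card A * (k - 1) * (k - 1)"
    unfolding M_def
  proof (rule degree_sum_le)
    fix l assume "l \<in> {..<k}"
    have "degree (f ^ (k - 1 - l)) \<le> degree f * (k - 1 - l)" by (rule degree_power_le)
    also have "\<dots> \<le> card A * (k - 1) * (k - 1)"
      by (intro mult_mono degree_f) auto
    finally have "degree (f ^ (k - 1 - l)) \<le> card A * (k - 1) * (k - 1)" .
    thus "degree (coeff N (k * l) * f ^ (k - 1 - l) * [:c ^ l:]) \<le>
        k * (D + card A * (k - 1)) + card A * (k - 1) * (k - 1)"
      using degN[of "k * l"] degree_mult_le[of "coeff N (k * l)" "f ^ (k - 1 - l)"]
      by (simp add: mult.commute[of _ "[:_:]"])
  qed auto
  also have "\<dots> \<le> k * (D + card A * k) + card A * k * k"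
    by (intro add_mono mult_mono) auto
  also have "\<dots> < q" using D by (simp add: power2_eq_square algebra_simps)
  finally have "degree M < degree ?Y" by (simp add: degree_power_eq)
  hence "M = 0" using dvdM dvd_imp_degree_le[of ?Y M] by fastforce
  have ord: "k dvd d" if "\<And>x. k dvd d * order x f" for d
  proof (rule m_coprime)
    fix x assume "x \<in> A"
    thus "k dvd d * m x" using that[of x] by (simp add: f_def order_prod_linear)
  qed
  have "P = 0"
    by (rule radical_norm_eq_0[OF z f0 c ord degP N_def]) (use \<open>M = 0\<close> in \<open>auto simp: M_def\<close>)
  hence "smult (inverse (\<gamma> i)) (H i * v i) = 0"
    using coeff_P[of i] i by simp
  moreover have "v i \<noteq> 0" by (simp add: v_def)
  ultimately show ?thesis using \<gamma>[of i] by simp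
qed

lemma auxiliary_cong:
  "[(\<Sum>i<k. \<Sum>j<J. r i j * monom 1 (q * j) * w i) = (\<Sum>i<k. (\<Sum>j<J. smult (y ^ j) (r i j)) * w i)]
    (mod [:- y, 1:] ^ q)"
proof -
  have "[(\<Sum>i<k. \<Sum>j<J. r i j * monom 1 q ^ j * w i) = (\<Sum>i<k. \<Sum>j<J. r i j * [:y:] ^ j * w i)]
      (mod [:- y, 1:] ^ q)"
    by (intro cong_sum cong_mult cong_pow cong_refl monom_cong_q)
  moreover have "monom (1 :: 'a) q ^ j = monom 1 (q * j)" for j
    by (simp add: monom_power)
  moreover have "(\<Sum>j<J. r i j * [:y:] ^ j * w i) = (\<Sum>j<J. smult (y ^ j) (r i j)) * w i" for i
    by (simp add: poly_const_pow sum_distrib_right)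
  ultimately show ?thesis by (simp only:)
qed

text \<open>Modulo \<open>(X - y)^q\<close> the relation becomes one between the \<open>w i\<close>,
  and \<open>combination_eq_0\<close> makes its coefficients vanish for each \<open>y\<close>
  outside \<open>A\<close>. A fixed coefficient of these, read as a polynomial in \<open>y\<close>
  of degree below \<open>J\<close>, then has at least \<open>q - card A \<ge> J\<close>
  zeros.\<close>

lemma auxiliary_nonzero:
  assumes r: "\<And>i j. i < k \<Longrightarrow> j < J \<Longrightarrow> degree (r i j) \<le> D"
    and D: "k * D + 2 * card A * k\<^sup>2 < q" and J: "J + card A \<le> q"
    and R: "(\<Sum>i<k. \<Sum>j<J. r i j * monom 1 (q * j) * w i) = 0"
    and i: "i < k" and j: "j < J"
  shows "r i j = 0"
proof (rule poly_eqI)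
  fix a
  have *: "(\<Sum>j<J. smult (y ^ j) (r i j)) = 0" if y: "y \<notin> A" for y
  proof (rule combination_eq_0[OF y _ D _ i])
    show "degree (\<Sum>j<J. smult (y ^ j) (r i j)) \<le> D" if "i < k" for i
      using r[OF that] by (intro degree_sum_le) (auto intro: order.trans[OF degree_smult_le])
    show "[(\<Sum>i<k. (\<Sum>j<J. smult (y ^ j) (r i j)) * w i) = 0] (mod [:- y, 1:] ^ q)"
      using auxiliary_cong[of r J y] unfolding R by (rule cong_sym)
  qed
  define p where "p = (\<Sum>j<J. monom (coeff (r i j) a) j)"
  have "degree p \<le> J - 1"
    unfolding p_def by (intro degree_sum_le) (auto intro: order.trans[OF degree_monom_le])
  moreover have "p = 0"
  proof (rule poly_eqI_degree[of "- A"])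
    show "poly p y = poly 0 y" if "y \<in> - A" for y
      using arg_cong[OF *[of y], of "\<lambda>p. coeff p a"] that
      by (simp add: p_def poly_sum poly_monom coeff_sum mult.commute)
    have "card (- A) = q - card A" by (simp add: Compl_eq_Diff_UNIV card_Diff_subset q_card)
    thus "degree p < card (- A)" "degree (0 :: 'a poly) < card (- A)"
      using J j \<open>degree p \<le> J - 1\<close> by auto
  qed
  hence "coeff p j = 0" by simp
  thus "coeff (r i j) a = coeff 0 a" using j by (simp add: p_def coeff_sum)
qed

end

section \<open>Hasse derivatives and Taylor coefficients\<close>

lemma coeff_linear_power_eq:
  fixes x :: "'a::comm_semiring_1"
  shows "coeff ([:x, 1:] ^ n) a = of_nat (n choose a) * x ^ (n - a)"
proof (cases "a \<le> n")
  case False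
  have "degree ([:x, 1:] ^ n) \<le> n"
    by (rule order.trans[OF degree_power_le]) simp
  thus ?thesis using False by (simp add: coeff_eq_0 binomial_eq_0)
qed (simp add: coeff_linear_poly_power)

text \<open>The \<open>n\<close>-th Hasse derivative: a binomial coefficient replaces division by
  \<open>n!\<close>, which may be zero in the field. Its value at \<open>x\<close> is the
  \<open>n\<close>-th Taylor coefficient there, by \<open>poly_hasse\<close>.\<close>

definition hasse :: "nat \<Rightarrow> 'a::comm_ring_1 poly \<Rightarrow> 'a poly" where
  "hasse n p = (\<Sum>i\<le>degree p. monom (of_nat (i choose n) * coeff p i) (i - n))"

lemma poly_hasse: "coeff (pcompose p [:x, 1:]) n = poly (hasse n p) x"
proof -
  have "pcompose p [:x, 1:] = pcompose (\<Sum>i\<le>degree p. monom (coeff p i) i) [:x, 1:]"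
    by (simp only: poly_as_sum_of_monoms)
  also have "\<dots> = (\<Sum>i\<le>degree p. smult (coeff p i) ([:x, 1:] ^ i))"
    by (simp add: pcompose_sum monom_altdef pcompose_smult pcompose_power pcompose_pCons)
  finally show ?thesis
    by (simp add: hasse_def coeff_sum coeff_linear_power_eq poly_sum poly_monom mult_ac)
qed

lemma coeff_hasse: "coeff (hasse n p) j = of_nat ((j + n) choose n) * coeff p (j + n)"
proof -
  have "coeff (hasse n p) j =
      (\<Sum>i\<le>degree p. if i = j + n then of_nat (i choose n) * coeff p i else 0)"
    unfolding hasse_def coeff_sum
  proof (intro sum.cong refl)
    fix i
    show "coeff (monom (of_nat (i choose n) * coeff p i) (i - n)) j =
        (if i = j + n then of_nat (i choose n) * coeff p i else 0)"
      by (cases "n \<le> i") (auto simp: binomial_eq_0)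
  qed
  also have "\<dots> = of_nat ((j + n) choose n) * coeff p (j + n)"
    by (auto simp: coeff_eq_0)
  finally show ?thesis .
qed

lemma hasse_diff: "hasse n (p - p') = hasse n p - hasse n p'"
  by (rule poly_eqI) (simp add: coeff_hasse algebra_simps)

lemma degree_hasse: "degree (hasse n p) \<le> degree p"
  by (rule degree_le) (auto simp: coeff_hasse coeff_eq_0)

text \<open>By the Leibniz rule \<open>n\<close> derivatives cost at most \<open>n\<close> powers of
  each factor, and the \<open>n\<close>-th power of the product repays them. The large exponents
  \<open>\<epsilon> d\<close> therefore stay out of the degree of \<open>T n p\<close>.
  Compatibility with differences is what the counting argument for the linear system uses.\<close>

lemma taylor_operator:
  fixes \<epsilon> :: "'a::field \<Rightarrow> nat"
  assumes "finite A"
  shows "\<exists>T :: nat \<Rightarrow> 'a poly \<Rightarrow> 'a poly.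
    (\<forall>n p p'. T n (p - p') = T n p - T n p') \<and>
    (\<forall>n p. degree (T n p) \<le> degree p + n * card A) \<and>
    (\<forall>n p x. coeff (pcompose (p * (\<Prod>d\<in>A. [:- d, 1:] ^ \<epsilon> d)) [:x, 1:]) n * (\<Prod>d\<in>A. x - d) ^ n =
       poly (T n p) x * (\<Prod>d\<in>A. (x - d) ^ \<epsilon> d))"
  using assms
proof (induction A rule: finite_induct)
  case empty
  show ?case
    by (intro exI[of _ hasse]) (auto simp: hasse_diff degree_hasse poly_hasse)
next
  case (insert d A)
  then obtain T where T: "\<And>n p p'. T n (p - p') = T n p - T n p'"
    "\<And>n p. degree (T n p) \<le> degree p + n * card A"
    "\<And>n p x. coeff (pcompose (p * (\<Prod>d\<in>A. [:- d, 1:] ^ \<epsilon> d)) [:x, 1:]) n * (\<Prod>d\<in>A. x - d) ^ n =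
       poly (T n p) x * (\<Prod>d\<in>A. (x - d) ^ \<epsilon> d)" by blast
  define L where "L = (\<Prod>d\<in>A. [:- d, 1:])"
  \<comment> \<open>Leibniz rule for the new factor: with \<open>a\<close> derivatives on it, the
    old factors receive only \<open>n - a\<close>, so \<open>L ^ a\<close> fills up their powers,
    and \<open>n - a\<close> powers of \<open>X - d\<close> remain.\<close>
  define T' where "T' n p = (\<Sum>a\<le>n. smult (of_nat (\<epsilon> d choose a))
      (L ^ a * ([:- d, 1:] ^ (n - a) * T (n - a) p)))" for n p
  have degL: "degree L \<le> card A"
    unfolding L_def using degree_prod_linear[of "\<lambda>_. 1" A] by simp
  show ?case
  proof (intro exI[of _ T'] conjI allI)
    fix n p p'
    show "T' n (p - p') = T' n p - T' n p'"
      by (simp add: T'_def T(1) right_diff_distrib smult_diff_right sum_subtractf)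
  next
    fix n p
    show "degree (T' n p) \<le> degree p + n * card (insert d A)"
      unfolding T'_def
    proof (rule degree_sum_le)
      fix a assume "a \<in> {..n}"
      hence a: "a \<le> n" by simp
      have "degree (L ^ a * ([:- d, 1:] ^ (n - a) * T (n - a) p)) \<le>
          card A * a + ((n - a) + (degree p + (n - a) * card A))"
        using degL
        by (intro order.trans[OF degree_mult_le] add_mono T(2) order.trans[OF degree_power_le])
          auto
      also have "\<dots> = degree p + n * card A + (n - a)"
      proof -
        obtain b where "n = a + b" using a by (auto simp: le_iff_add)
        thus ?thesis by (simp add: algebra_simps)
      qed
      also have "\<dots> \<le> degree p + n * card (insert d A)"
        using insert by simp
      finally show "degree (smult (of_nat (\<epsilon> d choose a))
          (L ^ a * ([:- d, 1:] ^ (n - a) * T (n - a) p))) \<le> degree p + n * card (insert d A)"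
        by (meson degree_smult_le order_trans)
    qed auto
  next
    fix n p x
    let ?F = "pcompose (p * (\<Prod>d\<in>A. [:- d, 1:] ^ \<epsilon> d)) [:x, 1:]"
    let ?l = "x - d" and ?P = "\<Prod>d\<in>A. x - d" and ?E = "\<Prod>d\<in>A. (x - d) ^ \<epsilon> d"
    have eq: "coeff (pcompose (p * (\<Prod>d\<in>insert d A. [:- d, 1:] ^ \<epsilon> d)) [:x, 1:]) n =
        coeff ([:?l, 1:] ^ \<epsilon> d * ?F) n"
      using insert by (simp add: pcompose_mult pcompose_power pcompose_pCons mult_ac)
    have "coeff (pcompose (p * (\<Prod>d\<in>insert d A. [:- d, 1:] ^ \<epsilon> d)) [:x, 1:]) n *
          (\<Prod>d\<in>insert d A. x - d) ^ n =
        (\<Sum>a\<le>n. of_nat (\<epsilon> d choose a) * ?l ^ (\<epsilon> d - a) * coeff ?F (n - a) * (?l * ?P) ^ n)"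
      using insert unfolding eq by (simp add: coeff_mult coeff_linear_power_eq sum_distrib_right)
    also have "\<dots> = (\<Sum>a\<le>n. of_nat (\<epsilon> d choose a) *
        (?P ^ a * (?l ^ (n - a) * poly (T (n - a) p) x)) * (?l ^ \<epsilon> d * ?E))"
    proof (intro sum.cong refl)
      fix a assume "a \<in> {..n}"
      hence a: "a \<le> n" by simp
      show "of_nat (\<epsilon> d choose a) * ?l ^ (\<epsilon> d - a) * coeff ?F (n - a) * (?l * ?P) ^ n =
        of_nat (\<epsilon> d choose a) * (?P ^ a * (?l ^ (n - a) * poly (T (n - a) p) x)) * (?l ^ \<epsilon> d * ?E)"
      \<comment> \<open>For \<open>a > \<epsilon> d\<close> the exponent
        \<open>\<epsilon> d - a\<close> is truncated, but the binomial coefficient is zero.\<close>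
      proof (cases "a \<le> \<epsilon> d")
        case True
        have "(?l * ?P) ^ n = ?l ^ n * (?P ^ a * ?P ^ (n - a))"
          using a by (simp add: power_mult_distrib flip: power_add)
        hence "of_nat (\<epsilon> d choose a) * ?l ^ (\<epsilon> d - a) * coeff ?F (n - a) * (?l * ?P) ^ n =
          of_nat (\<epsilon> d choose a) * (?l ^ (\<epsilon> d - a) * ?l ^ n) * ?P ^ a * (coeff ?F (n - a) * ?P ^ (n - a))"
          by (simp only: mult_ac)
        also have "?l ^ (\<epsilon> d - a) * ?l ^ n = ?l ^ (n - a) * ?l ^ \<epsilon> d"
          using True a by (simp add: add.commute flip: power_add)
        also have "coeff ?F (n - a) * ?P ^ (n - a) = poly (T (n - a) p) x * ?E"
          by (rule T(3))
        finally show ?thesis by (simp only: mult_ac)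
      qed (simp add: binomial_eq_0)
    qed
    also have "\<dots> = poly (T' n p) x * (\<Prod>d\<in>insert d A. (x - d) ^ \<epsilon> d)"
      using insert by (simp add: T'_def poly_sum sum_distrib_right L_def poly_prod)
    finally show "coeff (pcompose (p * (\<Prod>d\<in>insert d A. [:- d, 1:] ^ \<epsilon> d)) [:x, 1:]) n *
        (\<Prod>d\<in>insert d A. x - d) ^ n = poly (T' n p) x * (\<Prod>d\<in>insert d A. (x - d) ^ \<epsilon> d)" .
  qed
qed

lemma linear_power_dvd_from_shift:
  fixes p :: "'a::field poly"
  assumes "\<And>n. n < M \<Longrightarrow> coeff (pcompose p [:x, 1:]) n = 0"
  shows "[:- x, 1:] ^ M dvd p"
proof -
  have "monom 1 M dvd pcompose p [:x, 1:]"
    using assms by (simp add: monom_1_dvd_iff')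
  then obtain r where "pcompose p [:x, 1:] = monom 1 M * r" by blast
  hence "pcompose (pcompose p [:x, 1:]) [:- x, 1:] = pcompose (monom 1 M * r) [:- x, 1:]"
    by simp
  moreover have "pcompose (pcompose p [:x, 1:]) [:- x, 1:] = p"
    by (simp add: pcompose_pCons flip: pcompose_assoc)
  moreover have "pcompose (monom 1 M * r) [:- x, 1:] = [:- x, 1:] ^ M * pcompose r [:- x, 1:]"
    by (simp add: pcompose_mult monom_altdef pcompose_power pcompose_pCons)
  ultimately show ?thesis by (metis dvd_triv_left)
qed

text \<open>
  Linear algebra over a finite field is replaced by counting: two choices of coefficients have the
  same image, and their difference is a nonzero solution.
\<close>

lemma homogeneous_system_solution:
  fixes T :: "nat \<Rightarrow> nat \<Rightarrow> 'a::{finite,field} poly \<Rightarrow> 'a poly" and \<zeta> :: 'a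
  assumes diff: "\<And>i n p p'. T i n (p - p') = T i n p - T i n p'"
    and deg: "\<And>i n p. degree (T i n p) \<le> degree p + n * s"
    and J: "J > 0"
    and less: "(\<Sum>n<M. D + n * s + J) < k * J * (D + 1)"
  shows "\<exists>r. (\<forall>i<k. \<forall>j<J. degree (r i j) \<le> D) \<and> (\<exists>i<k. \<exists>j<J. r i j \<noteq> 0) \<and>
    (\<forall>n<M. (\<Sum>i<k. \<Sum>j<J. smult (\<zeta> ^ i) (monom 1 j * T i n (r i j))) = 0)"
proof -
  \<comment> \<open>\<open>I\<close> indexes the unknown coefficients of the \<open>r i j\<close>,
    and \<open>S\<close> the coefficients of the \<open>M\<close> polynomials that must vanish;
    \<open>less\<close> says that there are fewer equations than unknowns.\<close>
  define I where "I = {..<k} \<times> {..<J} \<times> {..D}"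
  define S where "S = Sigma {..<M} (\<lambda>n. {..<D + n * s + J})"
  define U where "U = I \<rightarrow>\<^sub>E (UNIV :: 'a set)"
  define r where "r u i j = (\<Sum>a\<le>D. monom (u (i, j, a)) a)" for u :: "nat \<times> nat \<times> nat \<Rightarrow> 'a" and i j
  define \<Phi> where "\<Phi> u n = (\<Sum>i<k. \<Sum>j<J. smult (\<zeta> ^ i) (monom 1 j * T i n (r u i j)))" for u n
  define \<Psi> where "\<Psi> u = restrict (\<lambda>(n, b). coeff (\<Phi> u n) b) S" for u
  have degr: "degree (r u i j) \<le> D" for u i j
    unfolding r_def by (intro degree_sum_le) (auto intro: order.trans[OF degree_monom_le])
  \<comment> \<open>As \<open>J > 0\<close>, this degree is below \<open>D + n * s + J\<close>, so
    agreement of the coefficients on \<open>S\<close> gives equality of the polynomials.\<close>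
  have deg\<Phi>: "degree (\<Phi> u n) \<le> J - 1 + (D + n * s)" for u n
    unfolding \<Phi>_def using degr
    by (intro degree_sum_le order.trans[OF degree_smult_le] order.trans[OF degree_mult_le] add_mono
        order.trans[OF deg] order.trans[OF degree_monom_le]) auto
  have "card (S \<rightarrow>\<^sub>E (UNIV :: 'a set)) = CARD('a) ^ (\<Sum>n<M. D + n * s + J)"
    by (subst card_PiE) (auto simp: S_def)
  also have "\<dots> < CARD('a) ^ (k * J * (D + 1))"
    using less card_field_ge_2[where 'a='a] by (intro power_strict_increasing) auto
  also have "\<dots> = card U"
    unfolding U_def by (subst card_PiE) (auto simp: I_def algebra_simps)
  finally have "card (S \<rightarrow>\<^sub>E (UNIV :: 'a set)) < card U" .
  moreover have "card (\<Psi> ` U) \<le> card (S \<rightarrow>\<^sub>E (UNIV :: 'a set))"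
    by (intro card_mono finite_PiE) (auto simp: S_def \<Psi>_def split: if_splits)
  ultimately have "\<not> inj_on \<Psi> U"
    by (intro pigeonhole) simp
  then obtain u u' where u: "u \<in> U" "u' \<in> U" "u \<noteq> u'" "\<Psi> u = \<Psi> u'"
    by (auto simp: inj_on_def)
  have eq: "\<Phi> u n = \<Phi> u' n" if "n < M" for n
  proof (rule poly_eqI)
    fix b
    show "coeff (\<Phi> u n) b = coeff (\<Phi> u' n) b"
    proof (cases "b < D + n * s + J")
      case True
      thus ?thesis using that fun_cong[OF u(4), of "(n, b)"] by (simp add: \<Psi>_def S_def)
    next
      case False
      thus ?thesis using deg\<Phi>[of u n] deg\<Phi>[of u' n] J by (simp add: coeff_eq_0)
    qed
  qed
  obtain i j a where ija: "i < k" "j < J" "a \<le> D" "u (i, j, a) \<noteq> u' (i, j, a)"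
    using u(1-3) PiE_ext[of u I "\<lambda>_. UNIV" u'] by (auto simp: U_def I_def)
  have "coeff (r u i j) a = u (i, j, a)" "coeff (r u' i j) a = u' (i, j, a)"
    using ija by (simp_all add: r_def coeff_sum)
  hence "r u i j - r u' i j \<noteq> 0" using ija by auto
  moreover have "(\<Sum>i<k. \<Sum>j<J. smult (\<zeta> ^ i) (monom 1 j * T i n (r u i j - r u' i j))) = 0"
    if "n < M" for n
  proof -
    have "(\<Sum>i<k. \<Sum>j<J. smult (\<zeta> ^ i) (monom 1 j * T i n (r u i j - r u' i j))) = \<Phi> u n - \<Phi> u' n"
      by (simp add: \<Phi>_def diff right_diff_distrib smult_diff_right sum_subtractf)
    thus ?thesis using eq[OF that] by simp
  qed
  moreover have "degree (r u i j - r u' i j) \<le> D" for i j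
    using degr by (intro degree_diff_le)
  ultimately show ?thesis
    using ija(1,2) by (intro exI[of _ "\<lambda>i j. r u i j - r u' i j"]) blast
qed

section \<open>Points where \<open>f ^ e\<close> takes a given value\<close>

context stepanov
begin

lemma poly_w:
  assumes "x \<notin> A"
  shows "poly (w i) x = (poly f x ^ e) ^ i"
proof -
  have "(x - d) ^ (i * m d mod k * e) = (x - d) ^ (m d * e * i)" if "d \<in> A" for d
  proof -
    have "x - d \<noteq> 0" using that assms by auto
    hence "(x - d) ^ (k * e) = 1"
      using finite_field_power_card_minus_1[of "x - d"] q_eq by (simp flip: q_card)
    moreover have "m d * e * i = k * e * (i * m d div k) + i * m d mod k * e"
    proof -
      define a b where "a = i * m d div k" and "b = i * m d mod k"
      have "i * m d = k * a + b" by (simp add: a_def b_def)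
      hence "m d * e * i = (k * a + b) * e" by (simp add: ac_simps)
      thus ?thesis unfolding a_def[symmetric] b_def[symmetric] by (simp add: algebra_simps)
    qed
    ultimately show ?thesis by (simp only: power_add power_mult power_one mult_1)
  qed
  thus ?thesis
    by (simp add: w_def f_def poly_prod prod_power_distrib flip: power_mult)
qed

text \<open>At such a point \<open>w i\<close> has the value \<open>\<zeta> ^ i\<close> and
  \<open>X^(q * j)\<close> reduces to \<open>x ^ j\<close>. Up to a nonzero factor, the Taylor
  coefficients are thus values of polynomials that do not depend on the point, and one system of
  equations serves all points at once.\<close>

lemma auxiliary_vanishes:
  assumes T: "\<And>i n p x. coeff (pcompose (p * w i) [:x, 1:]) n * (\<Prod>d\<in>A. x - d) ^ n =
      poly (T i n p) x * poly (w i) x"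
    and eq: "\<And>n. n < M \<Longrightarrow> (\<Sum>i<k. \<Sum>j<J. smult (\<zeta> ^ i) (monom 1 j * T i n (r i j))) = 0"
    and M: "M \<le> q" and x: "x \<notin> A" "poly f x ^ e = \<zeta>"
  shows "[:- x, 1:] ^ M dvd (\<Sum>i<k. \<Sum>j<J. r i j * monom 1 (q * j) * w i)"
proof -
  define Rx where "Rx = (\<Sum>i<k. (\<Sum>j<J. smult (x ^ j) (r i j)) * w i)"
  have "[:- x, 1:] ^ M dvd Rx"
  proof (rule linear_power_dvd_from_shift)
    fix n assume n: "n < M"
    have "coeff (pcompose Rx [:x, 1:]) n * (\<Prod>d\<in>A. x - d) ^ n =
        (\<Sum>i<k. \<Sum>j<J. x ^ j * (coeff (pcompose (r i j * w i) [:x, 1:]) n * (\<Prod>d\<in>A. x - d) ^ n))"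
      by (simp add: Rx_def pcompose_sum sum_distrib_right coeff_sum pcompose_smult mult.assoc)
    also have "\<dots> = poly (\<Sum>i<k. \<Sum>j<J. smult (\<zeta> ^ i) (monom 1 j * T i n (r i j))) x"
      unfolding T poly_w[OF x(1)] x(2) by (simp add: poly_sum poly_monom mult_ac)
    also have "\<dots> = 0" using eq[OF n] by simp
    finally show "coeff (pcompose Rx [:x, 1:]) n = 0" using x(1) by auto
  qed
  moreover have "[:- x, 1:] ^ q dvd (\<Sum>i<k. \<Sum>j<J. r i j * monom 1 (q * j) * w i) - Rx"
    using auxiliary_cong[of r J x] by (simp add: cong_iff_dvd_diff Rx_def)
  hence "[:- x, 1:] ^ M dvd (\<Sum>i<k. \<Sum>j<J. r i j * monom 1 (q * j) * w i) - Rx"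
    using le_imp_power_dvd[OF M] dvd_trans by blast
  ultimately have "[:- x, 1:] ^ M dvd (\<Sum>i<k. \<Sum>j<J. r i j * monom 1 (q * j) * w i) - Rx + Rx"
    by (intro dvd_add)
  thus ?thesis by simp
qed

text \<open>Zeros of a nonzero auxiliary polynomial are counted with multiplicity: its order is at
  least \<open>M\<close> at each point of the set, and the right-hand side bounds its
  degree.\<close>

lemma stepanov_inequality:
  assumes D: "k * D + 2 * card A * k\<^sup>2 < q" and J: "J + card A \<le> q" "J > 0"
    and M: "0 < M" "M \<le> q"
    and less: "(\<Sum>n<M. D + n * card A + J) < k * J * (D + 1)"
  shows "card {x. x \<notin> A \<and> poly f x ^ e = \<zeta>} * M \<le> D + q * (J - 1) + card A * ((k - 1) * e)"
proof -
  have "\<exists>T. \<forall>i. (\<forall>n p p'. T i n (p - p') = T i n p - T i n p') \<and>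
      (\<forall>n p. degree (T i n p) \<le> degree p + n * card A) \<and>
      (\<forall>n p x. coeff (pcompose (p * w i) [:x, 1:]) n * (\<Prod>d\<in>A. x - d) ^ n = poly (T i n p) x * poly (w i) x)"
  proof (rule choice, rule allI)
    fix i
    have "poly (w i) x = (\<Prod>d\<in>A. (x - d) ^ (i * m d mod k * e))" for x
      by (simp add: w_def poly_prod)
    thus "\<exists>T. (\<forall>n p p'. T n (p - p') = T n p - T n p') \<and>
      (\<forall>n p. degree (T n p) \<le> degree p + n * card A) \<and>
      (\<forall>n p x. coeff (pcompose (p * w i) [:x, 1:]) n * (\<Prod>d\<in>A. x - d) ^ n = poly (T n p) x * poly (w i) x)"
      using taylor_operator[of A "\<lambda>d. i * m d mod k * e"] by (simp add: w_def)
  qed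
  then obtain T where T: "\<And>i n p p'. T i n (p - p') = T i n p - T i n p'"
    "\<And>i n p. degree (T i n p) \<le> degree p + n * card A"
    "\<And>i n p x. coeff (pcompose (p * w i) [:x, 1:]) n * (\<Prod>d\<in>A. x - d) ^ n =
      poly (T i n p) x * poly (w i) x" by blast
  obtain r where "(\<forall>i<k. \<forall>j<J. degree (r i j) \<le> D) \<and> (\<exists>i<k. \<exists>j<J. r i j \<noteq> 0) \<and>
      (\<forall>n<M. (\<Sum>i<k. \<Sum>j<J. smult (\<zeta> ^ i) (monom 1 j * T i n (r i j))) = 0)"
    using homogeneous_system_solution[where T = T and \<zeta> = \<zeta>, OF T(1,2) J(2) less] ..
  hence r: "\<And>i j. i < k \<Longrightarrow> j < J \<Longrightarrow> degree (r i j) \<le> D" "\<exists>i<k. \<exists>j<J. r i j \<noteq> 0"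
    "\<And>n. n < M \<Longrightarrow> (\<Sum>i<k. \<Sum>j<J. smult (\<zeta> ^ i) (monom 1 j * T i n (r i j))) = 0"
    by simp_all
  define R where "R = (\<Sum>i<k. \<Sum>j<J. r i j * monom 1 (q * j) * w i)"
  define Z where "Z = {x. x \<notin> A \<and> poly f x ^ e = \<zeta>}"
  have R0: "R \<noteq> 0"
    using auxiliary_nonzero[of J r D] r(1,2) D J(1) unfolding R_def by blast
  have order: "M \<le> order x R" if "x \<in> Z" for x
    using auxiliary_vanishes[OF T(3) r(3) M(2)] that R0
    by (auto simp: Z_def R_def order_divides)
  have "card Z * M = (\<Sum>x\<in>Z. M)" by simp
  also have "\<dots> \<le> (\<Sum>x\<in>Z. order x R)" by (intro sum_mono order)
  also have "\<dots> \<le> (\<Sum>x | poly R x = 0. order x R)"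
  proof (rule sum_mono2)
    show "Z \<subseteq> {x. poly R x = 0}" using order M(1) R0 by (fastforce simp: order_root)
  qed auto
  also have "\<dots> \<le> degree R" by (rule sum_order_le_degree[OF R0])
  also have "degree R \<le> D + q * (J - 1) + card A * ((k - 1) * e)"
    unfolding R_def
  proof (intro degree_sum_le order.trans[OF degree_mult_le] add_mono degree_w)
    fix i j assume "i \<in> {..<k}" "j \<in> {..<J}"
    thus "degree (r i j) \<le> D" using r(1) by simp
    show "degree (monom (1 :: 'a) (q * j)) \<le> q * (J - 1)"
      using \<open>j \<in> {..<J}\<close> by (intro order.trans[OF degree_monom_le] mult_left_mono) auto
  qed auto
  finally show ?thesis by (simp add: Z_def)
qed

end

text \<open>\<open>M = k * J1\<close> is chosen close to the square root of \<open>q\<close>. Then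
  the main term \<open>q * J1 / M\<close> is exactly \<open>q / k\<close>, and the error
  \<open>2 * s * q / M\<close> is at most \<open>2 * s * sqrt q\<close>.\<close>

lemma (in stepanov) stepanov_bound:
  assumes A: "A \<noteq> {}" and k: "k \<ge> 2"
    and q: "8 * real k \<le> sqrt (real q)" "64 * card A * k\<^sup>2 \<le> q"
  shows "real (card {x. x \<notin> A \<and> poly f x ^ e = \<zeta>}) \<le> real q / real k + 2 * real (card A) * sqrt (real q)"
proof -
  define s where "s = card A"
  define Q where "Q = sqrt (real q)"
  define J1 where "J1 = nat \<lceil>Q / real k\<rceil>"
  define M where "M = k * J1"
  \<comment> \<open>The excess \<open>s + 1\<close> over \<open>J1\<close> makes the unknowns
    outnumber the equations. \<open>D\<close> is the largest degree that
    \<open>combination_eq_0\<close> admits: \<open>k * D + 2 * s * k\<^sup>2\<close> becomes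
    \<open>q - 1\<close>.\<close>
  define J where "J = J1 + s + 1"
  define D where "D = e - 2 * s * k"
  have s: "s \<ge> 1" using A by (simp add: s_def Suc_le_eq card_gt_0_iff)
  have k0: "k > 0" using k by simp
  have QQ: "Q * Q = real q" by (simp add: Q_def)
  have Q8k: "8 * real k \<le> Q" using q by (simp add: Q_def)
  hence Q16: "Q \<ge> 16" using k by linarith
  have sk: "64 * s * k\<^sup>2 \<le> q" using q by (simp add: s_def)
  have Qq: "Q \<le> real q / 16"
    using mult_right_mono[OF Q16, of Q] Q16 QQ by simp
  have q256: "real q \<ge> 256" using Q16 Qq by simp
  have J1: "Q / real k \<le> real J1" "real J1 < Q / real k + 1"
    using Q16 unfolding J1_def by (auto simp: of_nat_nat) linarith+
  have M_ge: "Q \<le> real M" using J1(1) k0 by (simp add: M_def field_simps)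
  have "real M < Q + real k" using J1(2) k0 by (simp add: M_def field_simps)
  hence M_le: "real M \<le> 9 / 8 * Q" using Q8k by simp
  have M2: "(real M)\<^sup>2 \<le> 81 / 64 * real q"
    using power_mono[OF M_le, of 2] QQ by (simp add: power2_eq_square)
  have Mq: "real M \<le> 9 / 128 * real q" using M_le Qq by simp
  have sk': "64 * real s * (real k)\<^sup>2 \<le> real q"
    using sk by (metis of_nat_mono of_nat_mult of_nat_numeral of_nat_power)
  have s_le: "256 * real s \<le> real q"
  proof -
    have "real s * 4 \<le> real s * (real k)\<^sup>2"
      using k power_mono[of 2 "real k" 2] by (intro mult_left_mono) auto
    thus ?thesis using sk' by simp
  qed
  have De: "D + 2 * s * k = e"
  proof -
    have "k * (2 * s * k) < q"
      using sk q256 by (simp add: power2_eq_square mult_ac)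
    hence "k * (2 * s * k) \<le> k * e" unfolding q_eq by linarith
    hence "2 * s * k \<le> e" using k0 by (simp only: mult_le_cancel1)
    thus ?thesis by (simp add: D_def)
  qed
  hence kD: "k * D + 2 * s * k\<^sup>2 + 1 = q"
    by (simp add: q_eq power2_eq_square algebra_simps flip: De)
  have J_le: "real J + real s \<le> real q"
  proof -
    have "real J1 \<le> real M" using k0 unfolding M_def of_nat_le_iff by simp
    thus ?thesis using Mq s_le q256 by (simp add: J_def)
  qed
  have "(\<Sum>n<M. D + n * s + J) < k * J * (D + 1)"
  proof -
    have sumn: "2 * (\<Sum>n<M. D + n * s + J) + s * M = 2 * M * (D + J) + s * M\<^sup>2" for M
      by (induction M) (auto simp: algebra_simps power2_eq_square)
    have "real (2 * M * (D + J) + s * M\<^sup>2) < real (2 * (k * J * (D + 1)) + s * M)"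
    proof -
      have kD': "real k * real D = real q - 2 * real s * (real k)\<^sup>2 - 1"
        using arg_cong[OF kD, of real] by simp
      have J1M: "2 * real J1 * real M \<le> real M * real M"
        using k mult_right_mono[of 2 "real k" "real J1"] by (intro mult_right_mono) (auto simp: M_def)
      have "real (2 * M * (D + J) + s * M\<^sup>2) =
          2 * real M * real D + 2 * real J1 * real M + 2 * (real s + 1) * real M + real s * (real M)\<^sup>2"
        by (simp add: J_def algebra_simps)
      also have "\<dots> \<le> 2 * real M * real D + (real s + 1) * ((real M)\<^sup>2 + 2 * real M)"
        using J1M by (simp add: power2_eq_square algebra_simps)
      \<comment> \<open>All terms besides \<open>2 * M * D\<close> fit into the share
        \<open>2 * (s + 1) * k * D\<close> contributed by the excess in \<open>J\<close>.\<close>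
      also have "(real s + 1) * ((real M)\<^sup>2 + 2 * real M) \<le>
          (real s + 1) * (2 * (real q - 2 * real s * (real k)\<^sup>2 - 1))"
        using M2 Mq sk' q256 by (intro mult_left_mono) auto
      also have "\<dots> = 2 * (real s + 1) * (real k * real D)" unfolding kD' by (simp add: algebra_simps)
      also have "2 * real M * real D + 2 * (real s + 1) * (real k * real D) <
          2 * real M * real D + 2 * (real s + 1) * (real k * real D) + 2 * real k * real J + real s * real M"
        using k0 by (simp add: J_def add_pos_nonneg)
      also have "\<dots> = real (2 * (k * J * (D + 1)) + s * M)"
        by (simp add: J_def M_def algebra_simps)
      finally show ?thesis by simp
    qed
    hence "2 * M * (D + J) + s * M\<^sup>2 < 2 * (k * J * (D + 1)) + s * M" by linarith
    thus ?thesis using sumn[of M] by linarith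
  qed
  hence main: "card {x. x \<notin> A \<and> poly f x ^ e = \<zeta>} * M \<le> D + q * (J - 1) + s * ((k - 1) * e)"
    using stepanov_inequality[of D J M \<zeta>] kD J_le Mq M_ge Q16 unfolding s_def[symmetric]
    by (simp add: J_def)
  \<comment> \<open>One \<open>s * q\<close> comes from \<open>J - 1 = J1 + s\<close>, the other
    from \<open>D\<close> and the degrees of the \<open>w i\<close> together.\<close>
  also have "\<dots> \<le> q * (J1 + 2 * s)"
  proof -
    have "D + s * ((k - 1) * e) \<le> s * e + s * ((k - 1) * e)"
      using De s by (intro add_right_mono) (metis le_add1 mult_le_mono1 mult_1 order_trans)
    also have "\<dots> = s * (k * e)"
      using k0 by (cases k) (auto simp: algebra_simps)
    also have "\<dots> \<le> s * q" by (simp add: q_eq)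
    finally show ?thesis by (simp add: J_def algebra_simps)
  qed
  finally have "real (card {x. x \<notin> A \<and> poly f x ^ e = \<zeta>} * M) \<le> real (q * (J1 + 2 * s))"
    by (rule of_nat_mono)
  hence "real (card {x. x \<notin> A \<and> poly f x ^ e = \<zeta>}) \<le> real q * (real J1 + 2 * real s) / real M"
    using M_ge Q16 by (simp add: field_simps)
  also have "\<dots> = real q / real k + 2 * real s * (real q / real M)"
  proof -
    have "real J1 > 0" using M_ge Q16 k0 by (auto simp: M_def intro: Nat.gr0I)
    thus ?thesis using k0 by (simp add: M_def field_simps)
  qed
  also have "real q / real M \<le> Q"
    using M_ge Q16 mult_left_mono[OF M_ge, of Q] by (simp add: field_simps QQ)
  finally show ?thesis by (simp add: s_def Q_def mult_left_mono)
qed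

subsection \<open>Counting by characters\<close>

lemma prim_root_cis:
  assumes "k > 0"
  shows "prim_root k (cis (2 * pi / real k))"
proof -
  have *: "cis (2 * pi / real k) ^ j = cis (2 * pi * real j / real k)" for j
    by (simp add: DeMoivre mult_ac)
  have one: "cis (2 * pi / real k) ^ k = 1"
    using assms by (simp add: *)
  have inj: "inj_on (\<lambda>j. cis (2 * pi * real j / real k)) {..<k}"
    using bij_betw_roots_unity[OF assms] by (simp add: bij_betw_def)
  have "cis (2 * pi / real k) ^ j = 1 \<longleftrightarrow> k dvd j" for j
  proof -
    have "cis (2 * pi / real k) ^ j = cis (2 * pi / real k) ^ (k * (j div k) + j mod k)" by simp
    also have "\<dots> = cis (2 * pi / real k) ^ (j mod k)"
      by (simp only: power_add power_mult one power_one mult_1)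
    also have "\<dots> = 1 \<longleftrightarrow> j mod k = 0"
      using inj_onD[OF inj, of "j mod k" 0] assms by (auto simp: *)
    finally show ?thesis by (simp add: dvd_eq_mod_eq_0)
  qed
  thus ?thesis using assms by (simp add: prim_root_def)
qed

text \<open>Upper bounds on the classes suffice: the powers of \<open>\<omega>\<close> sum to zero,
  so \<open>B\<close> may be subtracted from every class size. The resulting coefficients are all
  nonpositive, and their absolute values sum to \<open>k * B - card V\<close>.\<close>

lemma norm_sum_prim_root_le:
  fixes \<omega> :: complex
  assumes \<omega>: "prim_root k \<omega>" and k: "k \<ge> 2" and V: "finite V"
    and B: "\<And>j. j < k \<Longrightarrow> real (card {x \<in> V. h x mod k = j}) \<le> B"
  shows "norm (\<Sum>x\<in>V. \<omega> ^ h x) \<le> real k * B - real (card V)"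
proof -
  define N where "N j = card {x \<in> V. h x mod k = j}" for j
  have one: "\<omega> ^ k = 1" using \<omega> by (simp add: prim_root_def)
  hence "norm \<omega> ^ k = 1 ^ k" by (simp flip: norm_power)
  hence norm: "norm \<omega> = 1" using k by (subst (asm) power_eq_iff_eq_base) auto
  have h: "\<omega> ^ h x = \<omega> ^ (h x mod k)" for x
    using prim_root_power_eq[OF \<omega>] by (simp add: cong_def)
  have "(\<Sum>x\<in>V. \<omega> ^ h x) = (\<Sum>j<k. \<Sum>x | x \<in> V \<and> h x mod k = j. \<omega> ^ h x)"
    using k V by (intro sum.group[symmetric]) auto
  also have "\<dots> = (\<Sum>j<k. of_nat (N j) * \<omega> ^ j)"
  proof (intro sum.cong refl)
    fix j
    have "(\<Sum>x | x \<in> V \<and> h x mod k = j. \<omega> ^ h x) = (\<Sum>x | x \<in> V \<and> h x mod k = j. \<omega> ^ j)"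
      by (intro sum.cong) (auto simp: h)
    thus "(\<Sum>x | x \<in> V \<and> h x mod k = j. \<omega> ^ h x) = of_nat (N j) * \<omega> ^ j"
      by (simp add: N_def)
  qed
  also have "\<dots> = (\<Sum>j<k. of_real (real (N j) - B) * \<omega> ^ j) + of_real B * (\<Sum>j<k. \<omega> ^ (j * 1))"
    by (simp add: algebra_simps sum.distrib sum_subtractf sum_distrib_left)
  also have "(\<Sum>j<k. \<omega> ^ (j * 1)) = 0"
    using k by (subst sum_prim_root[OF \<omega>]) auto
  finally have "norm (\<Sum>x\<in>V. \<omega> ^ h x) = norm (\<Sum>j<k. of_real (real (N j) - B) * \<omega> ^ j)" by simp
  also have "\<dots> \<le> (\<Sum>j<k. norm (of_real (real (N j) - B) * \<omega> ^ j))" by (rule norm_sum)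
  also have "\<dots> = (\<Sum>j<k. B - real (N j))"
  proof (intro sum.cong refl)
    fix j assume "j \<in> {..<k}"
    hence "real (N j) \<le> B" using B by (simp add: N_def)
    thus "norm (of_real (real (N j) - B) * \<omega> ^ j) = B - real (N j)"
      unfolding norm_mult norm_power norm norm_of_real by simp
  qed
  also have "\<dots> = real k * B - real (\<Sum>j<k. N j)" by (simp add: sum_subtractf)
  also have "(\<Sum>j<k. N j) = card V"
  proof -
    have "(\<Sum>j<k. \<Sum>x | x \<in> V \<and> h x mod k = j. 1) = (\<Sum>x\<in>V. 1 :: nat)"
      using k V by (intro sum.group) auto
    thus ?thesis by (simp add: N_def)
  qed
  finally show ?thesis .
qed

text \<open>A character is summed over a product of powers of the \<open>(x - d) * c d\<close>, and
  its order may be a proper divisor of \<open>k\<close>. After division by the greatest common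
  divisor of \<open>k\<close> and all \<open>m d\<close>, the Stepanov bound applies to each
  fibre.\<close>

lemma character_sum_bound:
  fixes A :: "'a::{finite,field} set" and c :: "'a \<Rightarrow> 'a" and z :: 'a and \<omega> :: complex
  assumes z: "prim_root k z" and \<omega>: "prim_root k \<omega>" and q: "CARD('a) = k * e + 1"
    and large: "8 * real k \<le> sqrt (real CARD('a))" "64 * card A * k\<^sup>2 \<le> CARD('a)"
    and c: "\<And>d. d \<in> A \<Longrightarrow> c d \<noteq> 0"
    and l: "\<And>x d. x \<notin> A \<Longrightarrow> d \<in> A \<Longrightarrow> ((x - d) * c d) ^ e = z ^ l d x"
    and m: "\<And>d. d \<in> A \<Longrightarrow> m d < k" "\<exists>d\<in>A. m d \<noteq> 0"
  shows "norm (\<Sum>x\<in>-A. \<omega> ^ (\<Sum>d\<in>A. m d * l d x)) \<le>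
    2 * real k * real (card A) * sqrt (real CARD('a)) + real (card A)"
proof -
  define \<gamma> where "\<gamma> = Gcd (insert k (m ` A))"
  define k' where "k' = k div \<gamma>"
  define m' where "m' d = m d div \<gamma>" for d
  have k0: "k > 0" using z by (simp add: prim_root_def)
  have "\<gamma> dvd k" "\<gamma> dvd m d" if "d \<in> A" for d
    using that unfolding \<gamma>_def by (intro Gcd_dvd; simp)+
  moreover have "\<gamma> dvd k" by (simp add: \<gamma>_def)
  ultimately have k': "k = \<gamma> * k'" and m': "\<And>d. d \<in> A \<Longrightarrow> m d = \<gamma> * m' d"
    by (auto simp: k'_def m'_def)
  have \<gamma>0: "\<gamma> > 0" and k'0: "k' > 0" using k' k0 by (auto intro: Nat.gr0I)
  have m'_less: "m' d < k'" if "d \<in> A" for d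
    using m(1)[OF that] m'[OF that] k' \<gamma>0 by simp
  obtain d0 where d0: "d0 \<in> A" "m' d0 \<noteq> 0" using m(2) m' by force
  have k'2: "k' \<ge> 2" using m'_less[OF d0(1)] d0(2) by simp
  have k'k: "k' \<le> k" using k' \<gamma>0 by simp
  interpret stepanov A m' k' "\<gamma> * e" "CARD('a)" "z ^ \<gamma>"
  proof
    show "prim_root k' (z ^ \<gamma>)" using prim_root_power[of \<gamma> k' z] z k' by simp
    show "CARD('a) = k' * (\<gamma> * e) + 1" using q k' by simp
    show "k' dvd a" if "\<And>d. d \<in> A \<Longrightarrow> k' dvd a * m' d" for a
    proof -
      have "k dvd a * m d" if "d \<in> A" for d
        using \<open>\<And>d. d \<in> A \<Longrightarrow> k' dvd a * m' d\<close>[OF that] k' m'[OF that]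
        by (simp add: mult.left_commute[of a])
      hence "k dvd Gcd ((*) a ` insert k (m ` A))"
        by (intro Gcd_greatest) auto
      hence "k dvd a * \<gamma>" unfolding Gcd_mult \<gamma>_def by (simp only: normalize_nat_def id_apply)
      thus ?thesis using k' \<gamma>0 by (simp add: mult.commute)
    qed
  qed (use m'_less in auto)
  define B where "B = real CARD('a) / real k' + 2 * real (card A) * sqrt (real CARD('a))"
  define h where "h x = (\<Sum>d\<in>A. m' d * l d x)" for x
  \<comment> \<open>The scalars \<open>c d\<close> contribute only this constant, so a class of
    \<open>h\<close> modulo \<open>k'\<close> lies in one fibre of
    \<open>poly f x ^ (\<gamma> * e)\<close>.\<close>
  define C where "C = (\<Prod>d\<in>A. c d ^ (m d * e))"
  have C0: "C \<noteq> 0" using c by (simp add: C_def)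
  have fh: "poly f x ^ (\<gamma> * e) * C = (z ^ \<gamma>) ^ h x" if "x \<notin> A" for x
  proof -
    have "poly f x ^ (\<gamma> * e) * C = (\<Prod>d\<in>A. (((x - d) * c d) ^ e) ^ m d)"
      unfolding f_def C_def poly_prod prod_power_distrib prod.distrib[symmetric]
    proof (intro prod.cong refl)
      fix d assume "d \<in> A"
      thus "poly ([:- d, 1:] ^ m' d) x ^ (\<gamma> * e) * c d ^ (m d * e) = (((x - d) * c d) ^ e) ^ m d"
        by (simp add: m' power_mult_distrib mult_ac flip: power_mult)
    qed
    also have "\<dots> = (\<Prod>d\<in>A. (z ^ \<gamma>) ^ (m' d * l d x))"
      using l[OF that] by (intro prod.cong) (auto simp: m' mult_ac simp flip: power_mult)
    also have "\<dots> = (z ^ \<gamma>) ^ h x" by (simp add: h_def power_sum)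
    finally show ?thesis .
  qed
  have "norm (\<Sum>x\<in>-A. (\<omega> ^ \<gamma>) ^ h x) \<le> real k' * B - real (card (- A))"
  proof (rule norm_sum_prim_root_le)
    show "prim_root k' (\<omega> ^ \<gamma>)" using prim_root_power[of \<gamma> k' \<omega>] \<omega> k' by simp
    fix j assume "j < k'"
    have "card {x \<in> -A. h x mod k' = j} \<le> card {x. x \<notin> A \<and> poly f x ^ (\<gamma> * e) = (z ^ \<gamma>) ^ j / C}"
    proof (intro card_mono subsetI)
      fix x assume x: "x \<in> {x \<in> -A. h x mod k' = j}"
      hence "(z ^ \<gamma>) ^ h x = (z ^ \<gamma>) ^ j"
        using \<open>j < k'\<close> by (subst prim_root_power_eq[OF z]) (auto simp: cong_def)
      thus "x \<in> {x. x \<notin> A \<and> poly f x ^ (\<gamma> * e) = (z ^ \<gamma>) ^ j / C}"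
        using fh[of x] x C0 by (simp add: field_simps)
    qed auto
    also have "real \<dots> \<le> B"
      unfolding B_def
    proof (rule stepanov_bound)
      show "8 * real k' \<le> sqrt (real CARD('a))" using large(1) k'k by simp
      have "64 * card A * k'\<^sup>2 \<le> 64 * card A * k\<^sup>2" using k'k by (intro mult_mono power_mono) auto
      thus "64 * card A * k'\<^sup>2 \<le> CARD('a)" using large(2) by linarith
    qed (use d0 k'2 in auto)
    finally show "real (card {x \<in> -A. h x mod k' = j}) \<le> B" by simp
  qed (use k'2 in auto)
  also have "real (card (- A)) = real CARD('a) - real (card A)"
    by (simp add: Compl_eq_Diff_UNIV card_Diff_subset of_nat_diff card_mono)
  also have "real k' * B - (real CARD('a) - real (card A)) =
      2 * real k' * real (card A) * sqrt (real CARD('a)) + real (card A)"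
    using k'0 by (simp add: B_def distrib_left)
  also have "\<dots> \<le> 2 * real k * real (card A) * sqrt (real CARD('a)) + real (card A)"
    using k'k by (intro add_mono mult_right_mono) auto
  also have "(\<Sum>x\<in>-A. (\<omega> ^ \<gamma>) ^ h x) = (\<Sum>x\<in>-A. \<omega> ^ (\<Sum>d\<in>A. m d * l d x))"
  proof (intro sum.cong refl)
    fix x
    have "\<gamma> * h x = (\<Sum>d\<in>A. m d * l d x)"
      unfolding h_def sum_distrib_left by (intro sum.cong) (auto simp: m')
    thus "(\<omega> ^ \<gamma>) ^ h x = \<omega> ^ (\<Sum>d\<in>A. m d * l d x)" by (simp flip: power_mult)
  qed
  finally show ?thesis .
qed

text \<open>Summing \<open>\<omega> ^ (j * l)\<close> over \<open>j < k\<close> detects divisibility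
  of \<open>l\<close> by \<open>k\<close>. The product of these detectors over \<open>A\<close>
  expands into a sum over exponent families: the zero family gives \<open>q - card A\<close>, and
  each other one is bounded by \<open>character_sum_bound\<close>.\<close>

lemma card_cyclotomic_intersection_ge:
  fixes A :: "'a::{finite,field} set" and c :: "'a \<Rightarrow> 'a" and z :: 'a
  assumes z: "prim_root k z" and q: "CARD('a) = k * e + 1"
    and large: "8 * real k \<le> sqrt (real CARD('a))" "64 * card A * k\<^sup>2 \<le> CARD('a)"
    and c: "\<And>d. d \<in> A \<Longrightarrow> c d \<noteq> 0"
  shows "real k ^ card A * real (card {x. x \<notin> A \<and> (\<forall>d\<in>A. ((x - d) * c d) ^ e = 1)}) \<ge>
    real CARD('a) - real (card A) -
    real k ^ card A * (2 * real k * real (card A) * sqrt (real CARD('a)) + real (card A))"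
proof -
  define s where "s = card A"
  define b where "b = 2 * real k * real s * sqrt (real CARD('a)) + real s"
  define G where "G = {x. x \<notin> A \<and> (\<forall>d\<in>A. ((x - d) * c d) ^ e = 1)}"
  define \<omega> where "\<omega> = cis (2 * pi / real k)"
  have k0: "k > 0" using z by (simp add: prim_root_def)
  have \<omega>: "prim_root k \<omega>" unfolding \<omega>_def by (rule prim_root_cis[OF k0])
  have "\<exists>j<k. ((x - d) * c d) ^ e = z ^ j" if "x \<notin> A" "d \<in> A" for x d
  proof (rule prim_root_cover[OF z])
    have "(x - d) * c d \<noteq> 0" using that c by auto
    thus "(((x - d) * c d) ^ e) ^ k = 1"
      using finite_field_power_card_minus_1[of "(x - d) * c d"] q
      by (simp add: mult.commute[of e] flip: power_mult)
  qed
  hence "\<forall>d x. \<exists>j. x \<notin> A \<longrightarrow> d \<in> A \<longrightarrow> j < k \<and> ((x - d) * c d) ^ e = z ^ j" by blast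
  \<comment> \<open>\<open>l d x\<close> is a discrete logarithm to the base \<open>z\<close>; the
    condition at \<open>d\<close> says that \<open>k\<close> divides it.\<close>
  then obtain l where l: "\<And>x d. x \<notin> A \<Longrightarrow> d \<in> A \<Longrightarrow> l d x < k"
      "\<And>x d. x \<notin> A \<Longrightarrow> d \<in> A \<Longrightarrow> ((x - d) * c d) ^ e = z ^ l d x"
    by metis
  define P where "P = A \<rightarrow>\<^sub>E {..<k}"
  define S where "S m = (\<Sum>x\<in>-A. \<omega> ^ (\<Sum>d\<in>A. m d * l d x))" for m
  define m0 where "m0 = (\<lambda>d\<in>A. 0 :: nat)"
  have finP: "finite P" unfolding P_def by (intro finite_PiE) auto
  have m0: "m0 \<in> P" using k0 by (auto simp: m0_def P_def)
  have cardP: "card P = k ^ s" by (simp add: P_def card_PiE s_def)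
  have cardA: "real (card (- A)) = real CARD('a) - real s"
    by (simp add: Compl_eq_Diff_UNIV card_Diff_subset of_nat_diff card_mono s_def)
  have "(\<Sum>m\<in>P. S m) = (\<Sum>x\<in>-A. \<Sum>m\<in>P. \<Prod>d\<in>A. \<omega> ^ (m d * l d x))"
    unfolding S_def by (subst sum.swap) (simp add: power_sum)
  also have "\<dots> = (\<Sum>x\<in>-A. \<Prod>d\<in>A. \<Sum>j<k. \<omega> ^ (j * l d x))"
    unfolding P_def by (intro sum.cong refl prod_sum_PiE[symmetric]) auto
  also have "\<dots> = (\<Sum>x\<in>-A. if x \<in> G then of_nat (k ^ s) else 0)"
  proof (intro sum.cong refl)
    fix x assume x: "x \<in> - A"
    have iff: "k dvd l d x \<longleftrightarrow> ((x - d) * c d) ^ e = 1" if "d \<in> A" for d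
      using l(2)[of x d] that x z by (simp add: prim_root_def)
    show "(\<Prod>d\<in>A. \<Sum>j<k. \<omega> ^ (j * l d x)) = (if x \<in> G then of_nat (k ^ s) else 0)"
    proof (cases "x \<in> G")
      case True
      hence "(\<Prod>d\<in>A. \<Sum>j<k. \<omega> ^ (j * l d x)) = (\<Prod>d\<in>A. of_nat k)"
        by (intro prod.cong refl) (simp add: sum_prim_root[OF \<omega>] iff, simp add: G_def)
      thus ?thesis using True by (simp add: s_def)
    next
      case False
      then obtain d where "d \<in> A" "((x - d) * c d) ^ e \<noteq> 1" using x by (auto simp: G_def)
      thus ?thesis using False
        by (auto simp: sum_prim_root[OF \<omega>] iff intro!: prod_zero)
    qed
  qed
  also have "\<dots> = (\<Sum>x\<in>G. of_nat (k ^ s))"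
    by (intro sum.mono_neutral_cong_right) (auto simp: G_def)
  finally have total: "(\<Sum>m\<in>P. S m) = of_real (real k ^ s * real (card G))"
    by (simp add: mult.commute)
  have S0: "S m0 = of_real (real CARD('a) - real s)"
  proof -
    have "S m0 = (\<Sum>x\<in>-A. 1)" unfolding S_def by (intro sum.cong refl) (simp add: m0_def)
    thus ?thesis by (simp add: cardA[symmetric])
  qed
  have "norm (\<Sum>m\<in>P - {m0}. S m) \<le> (\<Sum>m\<in>P - {m0}. b)"
  proof (rule sum_norm_le)
    fix m assume m: "m \<in> P - {m0}"
    have "\<exists>d\<in>A. m d \<noteq> 0"
    proof (rule ccontr)
      assume "\<not> (\<exists>d\<in>A. m d \<noteq> 0)"
      hence "m = m0" using m m0 unfolding P_def by (intro PiE_ext[of m A]) (auto simp: m0_def)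
      thus False using m by simp
    qed
    thus "norm (S m) \<le> b"
      unfolding S_def b_def s_def using m
      by (intro character_sum_bound[OF z \<omega> q large c l(2)]) (auto simp: P_def)
  qed
  also have "\<dots> \<le> real k ^ s * b"
    using finP m0 cardP by (simp add: card_Diff_singleton b_def mult_right_mono)
  finally have small: "norm (\<Sum>m\<in>P - {m0}. S m) \<le> real k ^ s * b" .
  have "(\<Sum>m\<in>P - {m0}. S m) = of_real (real k ^ s * real (card G) - (real CARD('a) - real s))"
    using total S0 finP m0 by (simp add: sum_diff1)
  hence "\<bar>real k ^ s * real (card G) - (real CARD('a) - real s)\<bar> \<le> real k ^ s * b"
    using small by (simp only: norm_of_real)
  thus ?thesis by (simp add: G_def b_def s_def abs_le_iff)
qed

subsection \<open>Cyclotomic maps\<close>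

text \<open>A relation \<open>g ^ r = 1\<close> with \<open>0 < r < q - 1\<close> would leave at
  most \<open>r\<close> distinct powers of \<open>g\<close>, too few for all nonzero
  elements.\<close>

lemma mult_generator_prim_root:
  fixes g :: "'a::{finite,field}"
  assumes "mult_generator g"
  shows "prim_root (CARD('a) - 1) g"
proof -
  let ?n = "CARD('a) - 1"
  have n: "?n > 0" using card_field_ge_2[where 'a='a] by simp
  have g: "g \<noteq> 0"
  proof
    assume "g = 0"
    moreover have "g ^ 1 \<in> UNIV - {0}" using assms unfolding mult_generator_def by blast
    ultimately show False by simp
  qed
  have one: "g ^ ?n = 1" by (rule finite_field_power_card_minus_1[OF g])
  have "?n dvd j" if "g ^ j = 1" for j
  proof (rule ccontr)
    assume ndvd: "\<not> ?n dvd j"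
    define r where "r = j mod ?n"
    have r: "0 < r" "r < ?n" using ndvd n by (auto simp: r_def dvd_eq_mod_eq_0)
    have "g ^ j = g ^ (?n * (j div ?n) + r)" by (simp add: r_def)
    hence gr: "g ^ r = 1" using that one by (simp only: power_add power_mult power_one mult_1)
    have "UNIV - {0} \<subseteq> (\<lambda>i. g ^ i) ` {..<r}"
    proof
      fix x :: 'a assume "x \<in> UNIV - {0}"
      then obtain i where i: "x = g ^ i"
        using assms unfolding mult_generator_def by (metis imageE)
      have "g ^ i = g ^ (r * (i div r) + i mod r)" by simp
      also have "\<dots> = g ^ (i mod r)" using gr by (simp only: power_add power_mult power_one mult_1)
      finally show "x \<in> (\<lambda>i. g ^ i) ` {..<r}" using i r by auto
    qed
    hence "card (UNIV - {0 :: 'a}) \<le> card ((\<lambda>i. g ^ i) ` {..<r})" by (intro card_mono) auto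
    also have "\<dots> \<le> r" using card_image_le[of "{..<r}" "\<lambda>i. g ^ i"] by simp
    finally show False using r by (simp add: card_Diff_singleton)
  qed
  moreover have "g ^ j = 1" if "?n dvd j" for j
    using that one by (auto simp: power_mult elim!: dvdE)
  ultimately show ?thesis using n by (auto simp: prim_root_def)
qed

lemma mult_generator_obtain:
  assumes "mult_generator g" "x \<noteq> 0"
  obtains j where "x = g ^ j"
  using assms unfolding mult_generator_def by (metis DiffI UNIV_I imageE singletonD)

text \<open>Both weights are constant on the cosets of the group of \<open>e\<close>-th roots of
  unity. As their \<open>e\<close>-th powers agree, the two maps act in the same way on these
  cosets, and within a coset a nonzero constant multiplies injectively.\<close>

lemma weighted_permutation:
  fixes \<rho> \<mu> :: "'a::{finite,field} \<Rightarrow> 'a"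
  assumes inj: "inj (\<lambda>x. \<rho> x * x)" and e: "e > 0"
    and \<rho>: "\<And>x y. x \<noteq> 0 \<Longrightarrow> y \<noteq> 0 \<Longrightarrow> x ^ e = y ^ e \<Longrightarrow> \<rho> x = \<rho> y"
    and \<mu>: "\<And>x y. x \<noteq> 0 \<Longrightarrow> y \<noteq> 0 \<Longrightarrow> x ^ e = y ^ e \<Longrightarrow> \<mu> x = \<mu> y"
    and eq: "\<And>x. x \<noteq> 0 \<Longrightarrow> \<mu> x ^ e = \<rho> x ^ e"
  shows "bij (\<lambda>x. \<mu> x * x)"
proof -
  have \<rho>0: "\<rho> x \<noteq> 0" if "x \<noteq> 0" for x
    using injD[OF inj, of x 0] that by auto
  have \<mu>0: "\<mu> x \<noteq> 0" if "x \<noteq> 0" for x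
    using eq[OF that] \<rho>0[OF that] e by (metis power_eq_0_iff)
  have "inj (\<lambda>x. \<mu> x * x)"
  proof (rule injI)
    fix x y assume xy: "\<mu> x * x = \<mu> y * y"
    show "x = y"
    proof (cases "x = 0 \<or> y = 0")
      case True
      thus ?thesis using xy \<mu>0 by (metis mult_eq_0_iff)
    next
      case False
      \<comment> \<open>\<open>h\<close> is an \<open>e\<close>-th root of unity, so
        \<open>\<rho>\<close> agrees at \<open>y * h\<close> and \<open>y\<close>. Hence
        \<open>y * h\<close> and \<open>x\<close> have the same image under the injective map with
        weight \<open>\<rho>\<close>.\<close>
      define h where "h = (\<rho> x * x) / (\<rho> y * y)"
      have "(\<rho> x * x) ^ e = (\<rho> y * y) ^ e"
        using False eq arg_cong[OF xy, of "\<lambda>u. u ^ e"] by (simp add: power_mult_distrib)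
      hence h: "h ^ e = 1" "h \<noteq> 0" using False \<rho>0 by (auto simp: h_def power_divide)
      hence "\<rho> (y * h) = \<rho> y" using False by (intro \<rho>) (auto simp: power_mult_distrib)
      hence "\<rho> (y * h) * (y * h) = \<rho> x * x" using False \<rho>0 by (simp add: h_def)
      hence "y * h = x" by (rule injD[OF inj])
      hence "x ^ e = y ^ e" using h by (auto simp: power_mult_distrib)
      hence "\<mu> x = \<mu> y" using False by (intro \<mu>) auto
      thus ?thesis using xy \<mu>0[of y] False by simp
    qed
  qed
  thus ?thesis by (simp add: bij_def finite_UNIV_inj_surj)
qed

text \<open>Equal \<open>e\<close>-th powers mean that the exponents over \<open>g\<close> agree
  modulo \<open>k\<close>, hence modulo every divisor of \<open>k\<close>. This lets equations
  between \<open>e\<close>-th powers control cosets of all the indices involved.\<close>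

lemma cyclotomic_coset_power_eq:
  fixes g :: "'a::{finite,field}"
  assumes gen: "mult_generator g" and q: "CARD('a) = k * e + 1" and l: "l dvd k"
    and eq: "x ^ e = y ^ e" "y \<noteq> 0" and x: "x \<in> cyclotomic_coset g l i"
  shows "y \<in> cyclotomic_coset g l i"
proof -
  obtain j where j: "x = g ^ j" "[j = i] (mod l)" using x by (auto simp: cyclotomic_coset_def)
  obtain j' where j': "y = g ^ j'" using mult_generator_obtain[OF gen eq(2)] .
  have e: "e > 0" using q card_field_ge_2[where 'a='a] by (auto intro: Nat.gr0I)
  have "[j * e = j' * e] (mod (CARD('a) - 1))"
    using eq(1) prim_root_power_eq[OF mult_generator_prim_root[OF gen]]
    by (simp add: j j' flip: power_mult)
  hence "[j = j'] (mod k)"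
    using e by (simp add: q cong_def mult_mod_left[symmetric] flip: mult_mod_left)
  hence "[j' = i] (mod l)"
    using j(2) l by (meson cong_dvd_modulus_nat cong_sym cong_trans)
  thus ?thesis using j' by (auto simp: cyclotomic_coset_def)
qed

lemma cyclotomic_coset_disjoint:
  fixes g :: "'a::{finite,field}"
  assumes gen: "mult_generator g" and l: "l dvd CARD('a) - 1"
    and i: "g ^ j \<in> cyclotomic_coset g l i"
  shows "[j = i] (mod l)"
proof -
  obtain j' where j': "g ^ j = g ^ j'" "[j' = i] (mod l)" using i by (auto simp: cyclotomic_coset_def)
  hence "[j = j'] (mod (CARD('a) - 1))"
    using prim_root_power_eq[OF mult_generator_prim_root[OF gen]] by simp
  thus ?thesis using j'(2) l by (meson cong_dvd_modulus_nat cong_trans)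
qed

lemma cyclotomic_map_value:
  fixes g :: "'a::{finite,field}"
  assumes "mult_generator g" "cyclotomic_map g l a \<theta>" "x \<noteq> 0" "l > 0"
  obtains i where "i < l" "x \<in> cyclotomic_coset g l i" "\<theta> x / x = a i"
proof -
  obtain j where j: "x = g ^ j" using mult_generator_obtain[OF assms(1,3)] .
  have "x \<in> cyclotomic_coset g l (j mod l)"
    using j by (auto simp: cyclotomic_coset_def intro!: exI[of _ j])
  moreover have "j mod l < l" using assms(4) by simp
  ultimately show ?thesis
    using that[of "j mod l"] assms(2,3) by (auto simp: cyclotomic_map_def)
qed

lemma cyclotomic_map_quotient_eq:
  fixes g :: "'a::{finite,field}"
  assumes gen: "mult_generator g" and \<theta>: "cyclotomic_map g l a \<theta>" and l: "l > 0" "l dvd k"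
    and q: "CARD('a) = k * e + 1" and xy: "x \<noteq> 0" "y \<noteq> 0" "x ^ e = y ^ e"
  shows "\<theta> x / x = \<theta> y / y"
proof -
  obtain i where i: "i < l" "x \<in> cyclotomic_coset g l i" "\<theta> x / x = a i"
    using cyclotomic_map_value[OF gen \<theta> xy(1) l(1)] .
  have "y \<in> cyclotomic_coset g l i"
    by (rule cyclotomic_coset_power_eq[OF gen q l(2) xy(3,2) i(2)])
  thus ?thesis using \<theta> i xy(2) by (simp add: cyclotomic_map_def)
qed

lemma near_linear_construction:
  fixes g a b :: "'a::{finite,field}" and \<theta> :: "'i \<Rightarrow> 'a \<Rightarrow> 'a"
  assumes gen: "mult_generator g" and q: "CARD('a) = k * e + 1"
    and c: "c > 0" "c dvd k" and ab: "c \<ge> 2 \<Longrightarrow> a \<noteq> b"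
    and b: "b \<noteq> 0" "b \<noteq> 1" "b \<noteq> -1"
    and eq: "a ^ e = b ^ e" "(a - 1) ^ e = (b - 1) ^ e" "(a + 1) ^ e = (b + 1) ^ e"
    and l: "\<And>i. i \<in> I \<Longrightarrow> l i > 0 \<and> l i dvd k"
    and \<theta>: "\<And>i. i \<in> I \<Longrightarrow> \<theta> i \<in> cyclotomic_orthomorphisms g (l i)"
    and orth: "\<And>i x u. i \<in> I \<Longrightarrow> x \<noteq> 0 \<Longrightarrow> u \<in> {a, b} \<Longrightarrow> (u - \<theta> i x / x) ^ e = (- (\<theta> i x / x)) ^ e"
  shows "\<exists>\<phi>. \<phi> \<in> least_index_orthomorphisms g c \<and> near_linear g c \<phi> \<and>
    strong_orthomorphism \<phi> \<and> (\<forall>i\<in>I. orthogonal_maps \<phi> (\<theta> i))"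
proof -
  define C where "C = cyclotomic_coset g c 0"
  define \<mu> where "\<mu> x = (if x \<in> C then a else b)" for x
  define \<phi> where "\<phi> x = \<mu> x * x" for x
  have e: "e > 0" using q card_field_ge_2[where 'a='a] by (auto intro: Nat.gr0I)
  have cq: "c dvd CARD('a) - 1" using c(2) q by simp
  have \<mu>: "\<mu> x = \<mu> y" if "x \<noteq> 0" "y \<noteq> 0" "x ^ e = y ^ e" for x y
    using cyclotomic_coset_power_eq[OF gen q c(2) that(3,2)]
      cyclotomic_coset_power_eq[OF gen q c(2) that(3)[symmetric] that(1)]
    by (auto simp: \<mu>_def C_def)
  \<comment> \<open>The comparison is with the linear map of multiplier \<open>b + s\<close>; the
    shifts \<open>0\<close>, \<open>-1\<close> and \<open>1\<close> yield the three permutations of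
    a strong orthomorphism.\<close>
  have shift: "bij (\<lambda>x. (\<mu> x + s) * x)" if "b + s \<noteq> 0" "(a + s) ^ e = (b + s) ^ e" for s
  proof (rule weighted_permutation[of "\<lambda>_. b + s" e])
    show "inj (\<lambda>x. (b + s) * x)" using that(1) by (auto simp: inj_def)
    show "\<mu> x + s = \<mu> y + s" if "x \<noteq> 0" "y \<noteq> 0" "x ^ e = y ^ e" for x y
      using \<mu>[OF that] by simp
    show "(\<mu> x + s) ^ e = (b + s) ^ e" for x using that(2) by (simp add: \<mu>_def)
  qed (use e in auto)
  have bij: "bij \<phi>" "bij (\<lambda>x. \<phi> x - x)" "bij (\<lambda>x. \<phi> x + x)"
    using shift[of 0] shift[of "-1"] shift[of 1] b eq
    by (auto simp: \<phi>_def[abs_def] algebra_simps eq_neg_iff_add_eq_0)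
  define m where "m i = (if i = 0 then a else b)" for i :: nat
  have map: "cyclotomic_map g c m \<phi>"
    unfolding cyclotomic_map_def
  proof (intro conjI allI impI ballI cq)
    show "\<phi> 0 = 0" by (simp add: \<phi>_def)
    fix i x assume i: "i < c" and x: "x \<in> cyclotomic_coset g c i"
    obtain j where j: "x = g ^ j" "[j = i] (mod c)" using x by (auto simp: cyclotomic_coset_def)
    have "x \<in> C \<longleftrightarrow> i = 0"
    proof
      assume "x \<in> C"
      hence "[j = 0] (mod c)" using cyclotomic_coset_disjoint[OF gen cq] by (simp add: C_def j)
      thus "i = 0" using j(2) i by (simp add: cong_def)
    qed (use x in \<open>simp add: C_def\<close>)
    thus "\<phi> x = m i * x" by (simp add: \<phi>_def \<mu>_def m_def)
  qed
  have orthomorphism: "orthomorphism \<phi>" using bij by (simp add: orthomorphism_def)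
  hence cyc: "\<phi> \<in> cyclotomic_orthomorphisms g c"
    using map by (auto simp: cyclotomic_orthomorphisms_def)
  \<comment> \<open>With a smaller index \<open>l'\<close>, the points \<open>1\<close> and
    \<open>g ^ l'\<close> share a multiplier, but \<open>0 < l' < c\<close> puts only the first into
    \<open>C\<close>, so \<open>a = b\<close>. Such an \<open>l'\<close> exists only for
    \<open>c \<ge> 2\<close>, where \<open>ab\<close> excludes this.\<close>
  have least: "\<phi> \<notin> cyclotomic_orthomorphisms g l'" if l': "l' < c" "l' dvd CARD('a) - 1" for l'
  proof
    assume "\<phi> \<in> cyclotomic_orthomorphisms g l'"
    then obtain m' where m': "cyclotomic_map g l' m' \<phi>" by (auto simp: cyclotomic_orthomorphisms_def)
    have l0: "l' > 0" using l'(2) card_field_ge_2[where 'a='a] by (auto intro: Nat.gr0I)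
    have "g ^ 0 \<in> cyclotomic_coset g l' 0" "g ^ l' \<in> cyclotomic_coset g l' 0"
      unfolding cyclotomic_coset_def by (auto simp: cong_def intro: exI[of _ "0::nat"] exI[of _ l'])
    hence val: "\<phi> (g ^ 0) = m' 0 * g ^ 0" "\<phi> (g ^ l') = m' 0 * g ^ l'"
      using m' l0 unfolding cyclotomic_map_def by blast+
    have "g ^ 0 \<in> C" unfolding C_def cyclotomic_coset_def by (auto intro: exI[of _ "0::nat"])
    moreover have "g ^ l' \<notin> C"
      using cyclotomic_coset_disjoint[OF gen cq, of l' 0] l' l0 by (auto simp: C_def cong_def)
    moreover have "g \<noteq> 0" by (rule prim_root_nonzero[OF mult_generator_prim_root[OF gen]])
    ultimately have "a = b" using val by (simp add: \<phi>_def \<mu>_def)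
    thus False using ab l'(1) l0 by simp
  qed
  have "near_linear g c \<phi>"
    unfolding near_linear_def
  proof (intro conjI cyc exI[of _ m] map ballI)
    fix i assume "i \<in> {1..<c}"
    thus "m 0 \<noteq> m i" "m i = m 1" using ab by (auto simp: m_def)
  qed
  moreover have "orthogonal_maps \<phi> (\<theta> i)" if i: "i \<in> I" for i
  proof -
    obtain a' where a': "cyclotomic_map g (l i) a' (\<theta> i)" and "orthomorphism (\<theta> i)"
      using \<theta>[OF i] by (auto simp: cyclotomic_orthomorphisms_def)
    hence bij\<theta>: "bij (\<theta> i)" by (simp add: orthomorphism_def)
    have \<theta>0: "\<theta> i 0 = 0" using a' by (simp add: cyclotomic_map_def)
    have quot: "\<theta> i x / x = \<theta> i y / y" if "x \<noteq> 0" "y \<noteq> 0" "x ^ e = y ^ e" for x y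
      using l[OF i] by (intro cyclotomic_map_quotient_eq[OF gen a' _ _ q that]) auto
    \<comment> \<open>At zero the quotient has the default value \<open>0\<close>, consistent with
      \<open>\<theta> i 0 = 0\<close>.\<close>
    have times: "\<theta> i x / x * x = \<theta> i x" for x using \<theta>0 by (cases "x = 0") auto
    have "bij (\<lambda>x. (\<mu> x - \<theta> i x / x) * x)"
    proof (rule weighted_permutation[OF _ e])
      show "inj (\<lambda>x. - (\<theta> i x / x) * x)"
        using bij_is_inj[OF bij\<theta>] times by (auto simp: inj_def)
      show "- (\<theta> i x / x) = - (\<theta> i y / y)" "\<mu> x - \<theta> i x / x = \<mu> y - \<theta> i y / y"
        if "x \<noteq> 0" "y \<noteq> 0" "x ^ e = y ^ e" for x y
        using quot[OF that] \<mu>[OF that] by simp_all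
      show "(\<mu> x - \<theta> i x / x) ^ e = (- (\<theta> i x / x)) ^ e" if "x \<noteq> 0" for x
        using orth[OF i that] by (simp add: \<mu>_def)
    qed
    moreover have "(\<mu> x - \<theta> i x / x) * x = \<phi> x - \<theta> i x" for x
      unfolding left_diff_distrib times \<phi>_def ..
    ultimately show ?thesis by (simp add: orthogonal_maps_def)
  qed
  moreover have "strong_orthomorphism \<phi>" using orthomorphism bij by (simp add: strong_orthomorphism_def)
  moreover have "\<phi> \<in> least_index_orthomorphisms g c"
    using cyc least by (auto simp: least_index_orthomorphisms_def)
  ultimately show ?thesis by blast
qed

subsection \<open>The bound on the order of the field\<close>

text \<open>A large perfect square shows that the least element exists. The expression is quadratic
  in the square root \<open>x\<close> of the argument; its positivity at the least element forces
  \<open>\<alpha> * x > \<beta>\<close>, and from there on it increases.\<close>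

lemma least_threshold_le:
  fixes \<alpha> \<beta> \<gamma> :: real
  assumes \<alpha>: "\<alpha> > 0" and \<gamma>: "\<gamma> \<ge> 0"
    and q: "(LEAST m::nat. m > 0 \<and> \<alpha> * real m - \<beta> * sqrt (real m) - \<gamma> > 1) \<le> q"
  shows "\<alpha> * real q - \<beta> * sqrt (real q) - \<gamma> > 1"
proof -
  let ?P = "\<lambda>m::nat. m > 0 \<and> \<alpha> * real m - \<beta> * sqrt (real m) - \<gamma> > 1"
  obtain N :: nat where N: "(\<bar>\<beta>\<bar> + \<gamma> + 1) / \<alpha> < real N" using reals_Archimedean2 by blast
  have "(\<bar>\<beta>\<bar> + \<gamma> + 1) / \<alpha> > 0" using \<alpha> \<gamma> by simp
  hence N0: "N \<ge> 1" using N by (cases N) auto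
  have "?P (N * N)"
  proof -
    have "(\<bar>\<beta>\<bar> + \<gamma> + 1) * real N < \<alpha> * real N * real N"
      using N N0 \<alpha> by (intro mult_strict_right_mono) (auto simp: field_simps)
    hence "\<bar>\<beta>\<bar> * real N + (\<gamma> + 1) * real N < \<alpha> * real N * real N"
      by (simp only: add.assoc distrib_right[of "\<bar>\<beta>\<bar>"])
    moreover have "\<gamma> + 1 \<le> (\<gamma> + 1) * real N" using N0 \<gamma> mult_left_mono[of 1 "real N" "\<gamma> + 1"] by simp
    moreover have "\<beta> * real N \<le> \<bar>\<beta>\<bar> * real N" by (intro mult_right_mono) auto
    ultimately have "\<alpha> * real N * real N - \<beta> * real N - \<gamma> > 1" by linarith
    thus ?thesis using N0 by (simp add: real_sqrt_mult mult.assoc)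
  qed
  define m where "m = (LEAST m. ?P m)"
  have m: "m > 0" "\<alpha> * real m - \<beta> * sqrt (real m) - \<gamma> > 1"
    using LeastI[of ?P, OF \<open>?P (N * N)\<close>] by (auto simp: m_def)
  define x y where "x = sqrt (real m)" and "y = sqrt (real q)"
  have x: "x > 0" "x * x = real m" and y: "y * y = real q" "x \<le> y"
    using m q by (auto simp: x_def y_def m_def)
  have "x * (\<alpha> * x - \<beta>) > 0" using m(2) \<gamma> x by (simp add: algebra_simps flip: x_def)
  hence "\<alpha> * x - \<beta> > 0" using x(1) by (simp add: zero_less_mult_iff)
  moreover have "\<alpha> * y \<ge> 0" using \<alpha> x y by simp
  ultimately have "(y - x) * (\<alpha> * x - \<beta> + \<alpha> * y) \<ge> 0" using y by (intro mult_nonneg_nonneg) auto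
  hence "\<alpha> * real q - \<beta> * y \<ge> \<alpha> * real m - \<beta> * x"
    by (simp add: algebra_simps flip: x(2) y(1))
  thus ?thesis using m(2) by (simp add: x_def y_def)
qed

text \<open>\<open>Q\<close> stands for the square root of \<open>q\<close>. Cleared of
  denominators, \<open>cond\<close> bounds \<open>Q\<^sup>2\<close> below by
  \<open>K ^ S * (K\<^sup>2 * V) * Q\<close> plus nonnegative terms, so \<open>Q\<close> is at least
  that multiplier. The conclusions serve, in order, the case of no quotients, the two size
  conditions of \<open>card_cyclotomic_intersection_ge\<close>, and the count of candidates.\<close>

lemma field_order_bounds:
  fixes Q :: real and k S :: nat
  assumes k: "k \<ge> 2" and Q: "Q \<ge> 0"
    and cond: "Q\<^sup>2 / real k ^ (3 + S) -
      (real (3 + S) - 1 - real (3 + S) / real k + 1 / real k ^ (3 + S)) * Q - real (3 + S) / real k > 1"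
  shows "Q\<^sup>2 > real k ^ 3 + 3"
    and "S \<ge> 1 \<Longrightarrow> 8 * real k \<le> Q"
    and "S \<ge> 1 \<Longrightarrow> 64 * real S * (real k)\<^sup>2 \<le> Q\<^sup>2"
    and "S \<ge> 1 \<Longrightarrow> real S + real k ^ S * (2 * real k * real S * Q + real S + real k ^ 3 + 3) < Q\<^sup>2"
proof -
  define K where "K = real k"
  define s where "s = real S"
  \<comment> \<open>\<open>V\<close> is \<open>K\<close> times \<open>2 + s - (3 + s) / K\<close>,
    the coefficient of \<open>Q\<close> in \<open>cond\<close> without its summand
    \<open>1 / K ^ (3 + S)\<close>.\<close>
  define V where "V = (s + 2) * K - s - 3"
  have K: "K \<ge> 2" using k by (simp add: K_def)
  have s: "s \<ge> 0" by (simp add: s_def)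
  have KS: "K ^ S \<ge> 1" using K by (intro one_le_power) auto
  have K3: "K ^ 3 \<ge> 8" using power_mono[of 2 K 3] K by simp
  have VV: "2 * V \<ge> (s + 1) * K"
    using mult_left_mono[of 2 K "s + 3"] K s by (simp add: V_def algebra_simps)
  have V2: "V \<ge> s + 1"
    using mult_left_mono[of 2 K "s + 2"] K s by (simp add: V_def algebra_simps)
  have pow: "K ^ (3 + S) = K ^ 3 * K ^ S" by (simp add: power_add)
  have P: "K ^ (3 + S) > 0" using K by simp
  have KK: "K ^ 3 * (2 + s - (3 + s) / K) = K\<^sup>2 * V"
    using K by (simp add: V_def power3_eq_cube power2_eq_square field_simps)
  have "1 + (3 + s) / K + (2 + s - (3 + s) / K + 1 / K ^ (3 + S)) * Q < Q\<^sup>2 / K ^ (3 + S)"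
    using cond by (simp add: K_def s_def algebra_simps)
  hence "(1 + (3 + s) / K + (2 + s - (3 + s) / K + 1 / K ^ (3 + S)) * Q) * K ^ (3 + S) < Q\<^sup>2"
    using P by (simp add: pos_less_divide_eq)
  moreover have "(1 + (3 + s) / K + (w + 1 / r) * Q) * r = (1 + (3 + s) / K) * r + r * w * Q + Q"
    if "r > 0" for w r :: real
  proof -
    have "1 / r * r = 1" using that by simp
    hence "1 / r * Q * r = Q" by (metis mult.commute mult.left_commute mult_1_right)
    thus ?thesis by (simp only: distrib_right) (simp only: mult_ac add_ac)
  qed
  hence "(1 + (3 + s) / K + (2 + s - (3 + s) / K + 1 / K ^ (3 + S)) * Q) * K ^ (3 + S) =
      (1 + (3 + s) / K) * K ^ (3 + S) + K ^ (3 + S) * (2 + s - (3 + s) / K) * Q + Q"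
    using P by blast
  moreover have "K ^ (3 + S) * (2 + s - (3 + s) / K) = K ^ S * (K ^ 3 * (2 + s - (3 + s) / K))"
    by (simp only: pow mult_ac)
  ultimately have main: "(1 + (3 + s) / K) * K ^ (3 + S) + K ^ S * (K\<^sup>2 * V) * Q + Q < Q\<^sup>2"
    unfolding KK by simp
  have V0: "K ^ S * (K\<^sup>2 * V) * Q \<ge> 0" using V2 s K Q by simp
  have "(1 + (3 + s) / K) * K ^ (3 + S) \<ge> K ^ 3 + 3"
  proof -
    have "(1 + (3 + s) / K) * (K ^ 3 * 1) \<le> (1 + (3 + s) / K) * (K ^ 3 * K ^ S)"
      using KS K s by (intro mult_left_mono) auto
    moreover have "(1 + (3 + s) / K) * (K ^ 3 * 1) = K ^ 3 + (3 + s) * K\<^sup>2"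
      using K by (simp add: power3_eq_cube power2_eq_square field_simps)
    moreover have "3 * 1 \<le> (3 + s) * K\<^sup>2"
      using K s by (intro mult_mono) (auto intro: one_le_power)
    ultimately show ?thesis by (simp add: pow)
  qed
  thus "Q\<^sup>2 > real k ^ 3 + 3" using main V0 Q by (simp add: K_def)
  have "Q * (K ^ S * (K\<^sup>2 * V)) < Q * Q"
    using main K s Q by (simp add: power2_eq_square mult_ac) (smt (verit) zero_le_power divide_nonneg_nonneg mult_nonneg_nonneg)
  hence QV: "K ^ S * (K\<^sup>2 * V) \<le> Q" using Q by (simp add: mult_less_cancel_left)
  assume S: "S \<ge> 1"
  hence s1: "s \<ge> 1" by (simp add: s_def)
  have KS2: "K ^ S \<ge> 2 * s"
  proof -
    have "2 * S \<le> 2 ^ S" using S by (induction S rule: dec_induct) auto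
    hence "2 * s \<le> 2 ^ S" unfolding s_def by (metis of_nat_mono of_nat_mult of_nat_numeral of_nat_power)
    also have "\<dots> \<le> K ^ S" using K by (intro power_mono) auto
    finally show ?thesis .
  qed
  have QK: "2 * Q \<ge> K ^ S * (s + 1) * K ^ 3"
  proof -
    have "K ^ S * (K\<^sup>2 * ((s + 1) * K)) \<le> K ^ S * (K\<^sup>2 * (2 * V))"
      using VV K by (intro mult_left_mono) auto
    thus ?thesis using QV by (simp add: power3_eq_cube power2_eq_square algebra_simps)
  qed
  have Qs: "Q \<ge> (s + 1) * s * K ^ 3"
  proof -
    have "2 * s * ((s + 1) * K ^ 3) \<le> K ^ S * ((s + 1) * K ^ 3)"
      using KS2 K s by (intro mult_right_mono) auto
    thus ?thesis using QK by (simp add: mult_ac)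
  qed
  have s2: "(s + 1) * s \<ge> 2 * s" using s1 by simp
  have Qs2: "Q \<ge> 2 * s * K ^ 3"
    using Qs mult_right_mono[OF s2, of "K ^ 3"] K by simp
  have Q8: "Q \<ge> 8 * s * K"
  proof -
    have "8 * s * K \<le> 2 * s * K * K\<^sup>2"
      using power_mono[of 2 K 2] K s mult_left_mono[of 4 "K\<^sup>2" "2 * s * K"] by simp
    thus ?thesis using Qs2 by (simp add: power3_eq_cube power2_eq_square mult_ac)
  qed
  show "8 * real k \<le> Q"
  proof -
    have "1 * (8 * K) \<le> s * (8 * K)" using s1 K by (intro mult_right_mono) auto
    thus ?thesis using Q8 by (simp add: K_def mult_ac)
  qed
  show "64 * real S * (real k)\<^sup>2 \<le> Q\<^sup>2"
  proof -
    have "64 * s * K\<^sup>2 \<le> 64 * (s * s) * K\<^sup>2"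
      using s1 by (intro mult_right_mono mult_left_mono) auto
    also have "\<dots> = (8 * s * K)\<^sup>2" by (simp add: power2_eq_square)
    also have "\<dots> \<le> Q\<^sup>2" using Q8 s K by (intro power_mono) auto
    finally show ?thesis by (simp add: K_def s_def)
  qed
  \<comment> \<open>Of the \<open>2 * (s + 1)\<close> copies of \<open>K ^ S * K * Q\<close> gained
    here, \<open>2 * s\<close> pay for the character sums and the other two for all lower-order
    terms.\<close>
  have KV: "K * V \<ge> 2 * (s + 1)"
    using K V2 s by (intro mult_mono) auto
  have "K ^ S * K * (2 * (s + 1)) * Q \<le> K ^ S * K * (K * V) * Q"
    using KV K Q by (intro mult_left_mono mult_right_mono) auto
  hence step: "K ^ S * (2 * K * s * Q) + K ^ S * (2 * K * Q) < Q\<^sup>2"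
    using main V0 Q K s by (simp add: power2_eq_square algebra_simps)
      (smt (verit) zero_le_power divide_nonneg_nonneg mult_nonneg_nonneg)
  have "2 * s + K ^ 3 + 3 \<le> 2 * K * Q"
  proof -
    have "2 * s * 8 \<le> 2 * s * K ^ 3" using K3 s by (intro mult_left_mono) auto
    moreover have "2 * 1 * K ^ 3 \<le> 2 * s * K ^ 3" using s1 K by (intro mult_right_mono mult_left_mono) auto
    ultimately have "2 * s + K ^ 3 + 3 \<le> 2 * Q" using Qs2 K3 s1 by linarith
    also have "\<dots> \<le> 2 * K * Q" using K Q by (intro mult_right_mono) auto
    finally show ?thesis .
  qed
  hence "K ^ S * (2 * s + K ^ 3 + 3) \<le> K ^ S * (2 * K * Q)" using K by (intro mult_left_mono) auto
  moreover have "s \<le> K ^ S * s" using KS s mult_right_mono[OF KS s] by simp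
  ultimately show "real S + real k ^ S * (2 * real k * real S * Q + real S + real k ^ 3 + 3) < Q\<^sup>2"
    using step by (simp add: K_def s_def algebra_simps)
qed

section \<open>Choice of the two multipliers by the pigeonhole principle, and assembly of the
  result\<close>

lemma pair_in_same_cosets:
  fixes G :: "'a::{finite,field} set"
  assumes z: "prim_root k (z :: 'a)" and q: "CARD('a) = k * e + 1"
    and card: "card G > k ^ 3" and G: "\<And>x. x \<in> G \<Longrightarrow> x \<noteq> 0 \<and> x \<noteq> 1 \<and> x \<noteq> -1"
  obtains a b where "a \<in> G" "b \<in> G" "a \<noteq> b"
    "a ^ e = b ^ e" "(a - 1) ^ e = (b - 1) ^ e" "(a + 1) ^ e = (b + 1) ^ e"
proof -
  define U where "U = (\<lambda>j. z ^ j) ` {..<k}"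
  \<comment> \<open>Away from \<open>0\<close>, \<open>1\<close> and \<open>-1\<close> all three
    entries are \<open>k\<close>-th roots of unity, so \<open>F\<close> takes at most
    \<open>k ^ 3\<close> values on \<open>G\<close>.\<close>
  define F where "F x = (x ^ e, (x - 1) ^ e, (x + 1) ^ e)" for x :: 'a
  have U: "x ^ e \<in> U" if "x \<noteq> 0" for x
  proof -
    have "(x ^ e) ^ k = 1"
      using finite_field_power_card_minus_1[OF that] q by (simp add: mult.commute flip: power_mult)
    thus ?thesis using prim_root_cover[OF z] by (auto simp: U_def)
  qed
  have "F ` G \<subseteq> U \<times> U \<times> U"
    using G U by (auto simp: F_def eq_neg_iff_add_eq_0)
  hence "card (F ` G) \<le> card (U \<times> U \<times> U)" by (intro card_mono) (auto simp: U_def)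
  also have "\<dots> = card U ^ 3" by (simp add: card_cartesian_product power3_eq_cube)
  also have "\<dots> \<le> k ^ 3"
    using card_image_le[of "{..<k}" "\<lambda>j. z ^ j"] by (intro power_mono) (auto simp: U_def)
  finally have "\<not> inj_on F G" using card by (intro pigeonhole) simp
  thus ?thesis using that by (auto simp: inj_on_def F_def)
qed

theorem theorem4p5:
  fixes b :: "nat \<Rightarrow> nat"
    and n c t k q0 q :: nat
    and g :: "'a::{finite,field}"
    and \<theta> :: "nat \<Rightarrow> 'a \<Rightarrow> 'a"
  assumes b_pos: "\<And>i. i \<in> {1..n} \<Longrightarrow> b i > 0"
    and c_pos: "c > 0"
    and t: "t = 3 + (\<Sum>i=1..n. b i)"
    and k: "k = Lcm (insert c (b ` {1..n}))"
    and q0: "q0 = (LEAST m::nat. m > 0 \<and>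
      real m / real k ^ t
        - (real t - 1 - real t / real k + 1 / real k ^ t) * sqrt (real m)
        - real t / real k > 1)"
    and q: "q = CARD('a)"
    and k_dvd: "k dvd q - 1"
    and q_ge: "q \<ge> q0"
    and gen: "mult_generator g"
    and \<theta>: "\<And>i. i \<in> {1..n} \<Longrightarrow> \<theta> i \<in> cyclotomic_orthomorphisms g (b i)"
  shows "\<exists>\<phi>. \<phi> \<in> least_index_orthomorphisms g c \<and> near_linear g c \<phi> \<and>
    strong_orthomorphism \<phi> \<and> (\<forall>i\<in>{1..n}. orthogonal_maps \<phi> (\<theta> i))"
proof -
  define S where "S = (\<Sum>i=1..n. b i)"
  define Q where "Q = sqrt (real q)"
  \<comment> \<open>These quotients are multipliers of the \<open>\<theta> i\<close>, so each map
    contributes at most \<open>b i\<close> of them.\<close>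
  define A where "A = (\<Union>i\<in>{1..n}. (\<lambda>x. \<theta> i x / x) ` (UNIV - {0}))"
  have q2: "q \<ge> 2" unfolding q by (rule card_field_ge_2)
  have k0: "k > 0" using k_dvd q2 by (auto intro: Nat.gr0I)
  obtain e where e: "q - 1 = k * e" using k_dvd by blast
  hence qe: "CARD('a) = k * e + 1" using q2 q by simp
  have c_dvd: "c dvd k" and b_dvd: "\<And>i. i \<in> {1..n} \<Longrightarrow> b i dvd k"
    unfolding k by (intro dvd_Lcm; simp)+
  have Q2: "Q\<^sup>2 = real q" and Q0: "Q \<ge> 0" by (simp_all add: Q_def)
  have tS: "t = 3 + S" using t by (simp add: S_def)
  have cond: "Q\<^sup>2 / real k ^ t - (real t - 1 - real t / real k + 1 / real k ^ t) * Q - real t / real k > 1"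
    using least_threshold_le[of "1 / real k ^ t" "real t / real k"
        "real t - 1 - real t / real k + 1 / real k ^ t" q] q_ge k0
    unfolding q0 Q2 by (simp add: Q_def)
  have \<theta>_bij: "bij (\<theta> i)" and \<theta>_map: "\<exists>a. cyclotomic_map g (b i) a (\<theta> i)" if "i \<in> {1..n}" for i
    using \<theta>[OF that] by (auto simp: cyclotomic_orthomorphisms_def orthomorphism_def)
  have card_quotients: "card ((\<lambda>x. \<theta> i x / x) ` (UNIV - {0})) \<le> b i" if i: "i \<in> {1..n}" for i
  proof -
    obtain a where a: "cyclotomic_map g (b i) a (\<theta> i)" using \<theta>_map[OF i] by blast
    have "\<theta> i x / x \<in> a ` {..<b i}" if "x \<noteq> 0" for x
      using cyclotomic_map_value[OF gen a that b_pos[OF i]] by (metis imageI lessThan_iff)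
    hence "card ((\<lambda>x. \<theta> i x / x) ` (UNIV - {0})) \<le> card (a ` {..<b i})"
      by (intro card_mono) auto
    also have "\<dots> \<le> b i" using card_image_le[of "{..<b i}" a] by simp
    finally show ?thesis .
  qed
  have card_A: "card A \<le> S"
    unfolding A_def S_def by (intro order.trans[OF card_UN_le] sum_mono card_quotients) auto
  have A0: "0 \<notin> A"
  proof
    assume "0 \<in> A"
    then obtain i x where ix: "i \<in> {1..n}" "x \<noteq> 0" "0 = \<theta> i x / x"
      unfolding A_def by blast
    hence "\<theta> i x = 0" by simp
    moreover have "\<theta> i 0 = 0" using \<theta>_map[OF ix(1)] by (auto simp: cyclotomic_map_def)
    ultimately show False using bij_is_inj[OF \<theta>_bij[OF ix(1)]] ix(2) by (metis injD)
  qed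
  have quotient_in_A: "\<theta> i x / x \<in> A" if "i \<in> {1..n}" "x \<noteq> 0" for i x
    using that unfolding A_def by blast
  have construct: ?thesis
    if ab: "c \<ge> 2 \<Longrightarrow> a \<noteq> a'" "a' \<noteq> 0" "a' \<noteq> 1" "a' \<noteq> -1"
      "a ^ e = a' ^ e" "(a - 1) ^ e = (a' - 1) ^ e" "(a + 1) ^ e = (a' + 1) ^ e"
      and A: "\<And>u d. u \<in> {a, a'} \<Longrightarrow> d \<in> A \<Longrightarrow> (u - d) ^ e = (- d) ^ e" for a a'
    by (rule near_linear_construction[OF gen qe c_pos c_dvd ab _ \<theta>])
      (use b_pos b_dvd A quotient_in_A in auto)
  show ?thesis
  proof (cases "k = 1")
    case True
    \<comment> \<open>For \<open>k = 1\<close> the coefficient of \<open>Q\<close> is zero and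
      \<open>cond\<close> reads \<open>q - t > 1\<close>. All nonzero elements have
      \<open>e\<close>-th power one, so any \<open>a\<close> outside \<open>A\<close> and
      \<open>{0, 1, -1}\<close> gives a suitable linear map.\<close>
    have "real q > real S + 4" using cond True by (simp add: tS flip: Q2)
    hence "card (A \<union> {0, 1, -1}) < CARD('a)"
      using card_A card_Un_le[of A "{0, 1, -1}"] card_insert_le_m1[of 3 "{1, -1}" "0 :: 'a"]
        card_insert_le_m1[of 2 "{-1}" "1 :: 'a"] q by simp
    hence "A \<union> {0, 1, -1} \<noteq> UNIV" by force
    then obtain a where a: "a \<notin> A" "a \<noteq> 0" "a \<noteq> 1" "a \<noteq> -1" by blast
    have one: "x ^ e = 1" if "x \<noteq> 0" for x :: 'a
      using finite_field_power_card_minus_1[OF that] qe True by simp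
    have "c = 1" using c_dvd True by simp
    moreover have "(a - d) ^ e = (- d) ^ e" if "d \<in> A" for d
    proof -
      have "a - d \<noteq> 0" "- d \<noteq> 0" using that a(1) A0 by auto
      thus ?thesis using one[of "a - d"] one[of "- d"] by simp
    qed
    ultimately show ?thesis using a by (intro construct[of a a]) auto
  next
    case False
    hence k2: "k \<ge> 2" using k0 by simp
    have z: "prim_root k (g ^ e)"
      using prim_root_power[of e k g] mult_generator_prim_root[OF gen] qe by (simp add: mult.commute)
    \<comment> \<open>Division by \<open>(- d) ^ e\<close> brings the condition at \<open>d\<close>
      into the form counted by \<open>card_cyclotomic_intersection_ge\<close>, with scalars
      \<open>- inverse d\<close>.\<close>
    define G where "G = {x. x \<notin> A \<and> (\<forall>d\<in>A. ((x - d) * (- inverse d)) ^ e = 1)}"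
    note bounds = field_order_bounds[OF k2 Q0 cond[unfolded tS]]
    have "real k ^ 3 + 3 < real (card G)"
    proof (cases "A = {}")
      case True
      thus ?thesis using bounds(1) by (simp add: G_def Q2 q)
    next
      case False
      hence A1: "card A \<ge> 1" by (simp add: Suc_le_eq card_gt_0_iff)
      hence S1: "S \<ge> 1" using card_A by simp
      have "64 * real (card A) * (real k)\<^sup>2 \<le> 64 * real S * (real k)\<^sup>2"
        using card_A by (intro mult_right_mono) auto
      also have "\<dots> \<le> real q" using bounds(3)[OF S1] by (simp add: Q2)
      finally have "real (64 * card A * k\<^sup>2) \<le> real CARD('a)" by (simp add: q)
      hence "64 * card A * k\<^sup>2 \<le> CARD('a)" by (simp only: of_nat_le_iff)
      define K where "K = real k ^ card A"
      define Y where "Y = 2 * real k * real (card A) * Q + real (card A)"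
      have "real q - real (card A) - K * Y \<le> K * real (card G)"
        using bounds(2)[OF S1] A0 \<open>64 * card A * k\<^sup>2 \<le> CARD('a)\<close>
        unfolding G_def K_def Y_def Q_def q
        by (intro card_cyclotomic_intersection_ge[OF z qe]) auto
      \<comment> \<open>Quotients may coincide, so \<open>card A\<close> can be smaller than
        \<open>S\<close>; the error bound is monotone in this number.\<close>
      moreover have "real (card A) + K * (Y + real k ^ 3 + 3) \<le>
          real S + real k ^ S * (2 * real k * real S * Q + real S + real k ^ 3 + 3)"
        unfolding K_def Y_def using card_A k2 Q0
        by (intro add_mono mult_mono power_increasing mult_nonneg_nonneg add_nonneg_nonneg) auto
      moreover note bounds(4)[OF S1]
      moreover have "K * (Y + real k ^ 3 + 3) = K * Y + K * (real k ^ 3 + 3)"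
        by (simp add: algebra_simps)
      ultimately have "K * (real k ^ 3 + 3) < K * real (card G)"
        unfolding Q2 by linarith
      thus ?thesis using k0 by (simp add: K_def)
    qed
    hence "real (k ^ 3 + 3) < real (card G)" by simp
    hence "k ^ 3 + 3 < card G" by (simp only: of_nat_less_iff)
    \<comment> \<open>The surplus \<open>3\<close> in the count pays for removing \<open>0\<close>,
      \<open>1\<close> and \<open>-1\<close>.\<close>
    moreover have "card G - card {0, 1, -1 :: 'a} \<le> card (G - {0, 1, -1})"
      by (rule diff_card_le_card_Diff) simp
    moreover have "card {0, 1, -1 :: 'a} \<le> 3" by (simp add: card_insert_if)
    ultimately have card_G: "card (G - {0, 1, -1}) > k ^ 3" by linarith
    obtain a a' where a: "a \<in> G - {0, 1, -1}" "a' \<in> G - {0, 1, -1}" "a \<noteq> a'"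
      "a ^ e = a' ^ e" "(a - 1) ^ e = (a' - 1) ^ e" "(a + 1) ^ e = (a' + 1) ^ e"
      by (rule pair_in_same_cosets[OF z qe card_G]) auto
    have "(u - d) ^ e = (- d) ^ e" if "u \<in> {a, a'}" "d \<in> A" for u d
    proof -
      have "((u - d) * (- inverse d)) ^ e = 1" using that a(1,2) by (auto simp: G_def)
      moreover have "d \<noteq> 0" using that(2) A0 by auto
      hence "u - d = (u - d) * (- inverse d) * (- d)" by simp
      hence "(u - d) ^ e = ((u - d) * (- inverse d)) ^ e * (- d) ^ e"
        by (metis power_mult_distrib)
      ultimately show ?thesis by simp
    qed
    thus ?thesis using a by (intro construct[of a a']) auto
  qed
qed

end
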